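(* Let $H$ be a separable infinite-dimensional Hilbert space and let $\Lambda\subset\Gamma$ be countable. Consider the following two properties of an operator $T$ on $H$: (1) there exists a sequence $\{n_j\}_{j=1}^\infty\subset\mathbb{N}$ with density $1$ such that $\lim_{j\to\infty}T^{n_j}=0$ weakly; (2) for every $\lambda\in\Lambda$ there exists a sequence $\{n_j^{(\lambda)}\}_{j=1}^\infty\subset\mathbb{N}$ with $\lim_{j\to\infty}n_j^{(\lambda)}=\infty$ such that $\lim_{j\to\infty}T^{n_j^{(\lambda)}}=\lambda I$ strongly. Then the set of all operators satisfying (1) and (2) is residual in $\mathcal{C}$ for the weak operator topology, residual in $\mathcal{I}$ for the strong operator topology, and residual in $\mathcal{U}$ for the strong$^*$ operator topology.
   Context: $H$ is a complex Hilbert space, $I$ is the identity operator on $H$, and $\Gamma=\{z\in\mathbb{C}:|z|=1\}$ is the unit circle. $\mathcal{C}$ is the set of all contractions on $H$ (linear operators $T$ with $\|T\|\le 1$), $\mathcal{I}$ the set of all (not necessarily surjective) linear isometries on $H$, and $\mathcal{U}$ the set of all unitary operators on $H$. The strong$^*$ operator topology is the one defined by the seminorms $p_x(T)=\sqrt{\|Tx\|^2+\|T^*x\|^2}$, $x\in H$. Each of $\mathcal{C}$ (weak operator topology), $\mathcal{I}$ (strong operator topology), $\mathcal{U}$ (strong$^*$ operator topology) is completely metrizable. A subset of such a space is residual if its complement in that space is of first category, i.e. a countable union of nowhere dense sets; the residual set is formed by the operators of the respective space that satisfy (1) and (2). Weak (strong) convergence of operators means convergence in the weak (strong) operator topology.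 The density of a set $M\subset\mathbb{N}$ is $d(M)=\lim_{n\to\infty}\frac{\#(M\cap\{1,\ldots,n\})}{n}$ whenever this limit exists. A sequence $\{n_j\}\subset\mathbb{N}$ with density $1$ means a strictly increasing sequence (a subsequence of $\mathbb{N}$) whose set of values has density $1$. *)

theory Defs
  imports "HOL-Analysis.Analysis"
begin

section \<open>Complex Hilbert spaces\<close>

class complex_vector = real_vector +
  fixes scaleC :: "complex \<Rightarrow> 'a \<Rightarrow> 'a"  (infixr \<open>*\<^sub>C\<close> 75)
  assumes scaleC_add_right: "a *\<^sub>C (x + y) = a *\<^sub>C x + a *\<^sub>C y"
    and scaleC_add_left: "(a + b) *\<^sub>C x = a *\<^sub>C x + b *\<^sub>C x"
    and scaleC_scaleC: "a *\<^sub>C (b *\<^sub>C x) = (a * b) *\<^sub>C x"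
    and scaleC_one: "1 *\<^sub>C x = x"
    and scaleR_scaleC: "r *\<^sub>R x = complex_of_real r *\<^sub>C x"

interpretation complex_vector: vector_space "scaleC :: complex \<Rightarrow> 'a \<Rightarrow> 'a::complex_vector"
  by unfold_locales (fact scaleC_add_right scaleC_add_left scaleC_scaleC scaleC_one)+

text \<open>The inner product is linear in the first argument and conjugate-linear in the second.
  Its real part is the inner product of the underlying real space; together with conjugate
  symmetry this gives positive definiteness and the relation between the norm and the complex
  inner product, see \<open>cinner_self\<close> and \<open>norm_eq_sqrt_cinner\<close> below.\<close>

class complex_inner = complex_vector + real_inner +
  fixes cinner :: "'a \<Rightarrow> 'a \<Rightarrow> complex"
  assumes cinner_commute: "cinner x y = cnj (cinner y x)"
    and cinner_add_left: "cinner (x + y) z = cinner x z + cinner y z"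
    and cinner_scaleC_left: "cinner (a *\<^sub>C x) y = a * cinner x y"
    and inner_eq_Re_cinner: "inner x y = Re (cinner x y)"

class complex_hilbert_space = complex_inner + complete_space

lemma cinner_self: "cinner x x = complex_of_real ((norm x)\<^sup>2)"
proof -
  have "Im (cinner x x) = 0"
    using cinner_commute[of x x] by (metis complex_cnj_cancel_iff Reals_cnj_iff complex_is_Real_iff)
  then show ?thesis
    by (simp add: complex_eq_iff inner_eq_Re_cinner[symmetric] power2_norm_eq_inner)
qed

lemma norm_eq_sqrt_cinner: "norm x = sqrt (cmod (cinner x x))"
  by (simp add: cinner_self norm_power)

lemma norm_scaleC: "norm (a *\<^sub>C x) = cmod a * norm (x :: 'a::complex_inner)"
proof -
  have "cinner (a *\<^sub>C x) (a *\<^sub>C x) = a * cnj a * cinner x x"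
    by (metis cinner_commute cinner_scaleC_left complex_cnj_mult mult.assoc)
  then have "cmod (cinner (a *\<^sub>C x) (a *\<^sub>C x)) = (cmod a)\<^sup>2 * cmod (cinner x x)"
    by (simp add: norm_mult power2_eq_square)
  then show ?thesis
    by (simp add: norm_eq_sqrt_cinner real_sqrt_mult)
qed

definition infinite_dimensional :: "'a::complex_vector itself \<Rightarrow> bool" where
  "infinite_dimensional _ \<longleftrightarrow>
     \<not> (\<exists>B :: 'a set. finite B \<and> complex_vector.span B = UNIV)"


section \<open>Operators\<close>

text \<open>The type \<open>'a \<Rightarrow>\<^sub>L 'a\<close> consists of the bounded real-linear operators; the bounded operators
  on a complex space are the complex-linear ones among them.\<close>

definition bounded_operators :: "('a::complex_inner \<Rightarrow>\<^sub>L 'a) set" where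
  "bounded_operators = {T. \<forall>c x. blinfun_apply T (c *\<^sub>C x) = c *\<^sub>C blinfun_apply T x}"

definition adjoint_op :: "('a::complex_inner \<Rightarrow>\<^sub>L 'a) \<Rightarrow> 'a \<Rightarrow>\<^sub>L 'a" where
  "adjoint_op T = (THE S. \<forall>x y. cinner (blinfun_apply T x) y = cinner x (blinfun_apply S y))"

lemma adjoint_op_eqI:
  assumes "\<And>x y. cinner (blinfun_apply T x) y = cinner x (blinfun_apply S y)"
  shows "adjoint_op T = S"
  unfolding adjoint_op_def
proof (rule the_equality)
  show "\<forall>x y. cinner (blinfun_apply T x) y = cinner x (blinfun_apply S y)"
    using assms by blast
next
  fix R
  assume R: "\<forall>x y. cinner (blinfun_apply T x) y = cinner x (blinfun_apply R y)"
  show "R = S"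
  proof (rule blinfun_eqI)
    fix y
    have "inner x (blinfun_apply R y) = inner x (blinfun_apply S y)" for x
      using assms R by (metis inner_eq_Re_cinner)
    then show "blinfun_apply R y = blinfun_apply S y"
      by (metis vector_eq_ldot)
  qed
qed

primrec power_op :: "('a::real_normed_vector \<Rightarrow>\<^sub>L 'a) \<Rightarrow> nat \<Rightarrow> 'a \<Rightarrow>\<^sub>L 'a" where
  "power_op T 0 = id_blinfun"
| "power_op T (Suc n) = T o\<^sub>L power_op T n"

lift_definition scalar_op :: "complex \<Rightarrow> 'a::complex_inner \<Rightarrow>\<^sub>L 'a" is "\<lambda>c x. c *\<^sub>C x"
proof
  fix c :: complex and x y :: 'a and r :: real
  show "c *\<^sub>C (x + y) = c *\<^sub>C x + c *\<^sub>C y"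
    by (rule scaleC_add_right)
  show "c *\<^sub>C (r *\<^sub>R x) = r *\<^sub>R (c *\<^sub>C x)"
    by (simp add: scaleR_scaleC scaleC_scaleC mult.commute)
  show "\<exists>K. \<forall>x::'a. norm (c *\<^sub>C x) \<le> norm x * K"
    by (metis norm_scaleC mult.commute order_refl)
qed

definition contractions :: "('a::complex_inner \<Rightarrow>\<^sub>L 'a) set" where
  "contractions = {T \<in> bounded_operators. norm T \<le> 1}"

definition isometries :: "('a::complex_inner \<Rightarrow>\<^sub>L 'a) set" where
  "isometries = {T \<in> bounded_operators. \<forall>x. norm (blinfun_apply T x) = norm x}"

definition unitaries :: "('a::complex_inner \<Rightarrow>\<^sub>L 'a) set" where
  "unitaries = {T \<in> bounded_operators.
     adjoint_op T o\<^sub>L T = id_blinfun \<and> T o\<^sub>L adjoint_op T = id_blinfun}"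


section \<open>Operator topologies\<close>

text \<open>The topology on \<open>V\<close> defined by a family \<open>P\<close> of seminorms: the open balls of the individual
  seminorms form a subbase.\<close>

definition seminorm_topology :: "'b::real_vector set \<Rightarrow> ('b \<Rightarrow> real) set \<Rightarrow> 'b topology" where
  "seminorm_topology V P =
     topology_generated_by {{S \<in> V. p (S - T) < e} | p T e. p \<in> P \<and> T \<in> V \<and> 0 < e}"

definition weak_operator_topology :: "('a::complex_inner \<Rightarrow>\<^sub>L 'a) topology" where
  "weak_operator_topology =
     seminorm_topology bounded_operators
       {\<lambda>T. cmod (cinner (blinfun_apply T x) y) | x y. True}"

definition strong_star_operator_topology :: "('a::complex_inner \<Rightarrow>\<^sub>L 'a) topology" where
  "strong_star_operator_topology =
     seminorm_topology bounded_operators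
       {\<lambda>T. sqrt ((norm (blinfun_apply T x))\<^sup>2 + (norm (blinfun_apply (adjoint_op T) x))\<^sup>2)
         | x. True}"


section \<open>Category and density\<close>

definition nowhere_dense_in :: "'b topology \<Rightarrow> 'b set \<Rightarrow> bool" where
  "nowhere_dense_in X A \<longleftrightarrow> A \<subseteq> topspace X \<and> X interior_of (X closure_of A) = {}"

definition first_category_in :: "'b topology \<Rightarrow> 'b set \<Rightarrow> bool" where
  "first_category_in X A \<longleftrightarrow>
     (\<exists>\<N>. countable \<N> \<and> (\<forall>N\<in>\<N>. nowhere_dense_in X N) \<and> A = \<Union>\<N>)"

definition residual_in :: "'b topology \<Rightarrow> 'b set \<Rightarrow> bool" where
  "residual_in X A \<longleftrightarrow> A \<subseteq> topspace X \<and> first_category_in X (topspace X - A)"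

definition has_density :: "nat set \<Rightarrow> real \<Rightarrow> bool" where
  "has_density M d \<longleftrightarrow> (\<lambda>n. real (card (M \<inter> {1..n})) / real n) \<longlonglongrightarrow> d"


section \<open>The two properties\<close>

text \<open>Here the natural numbers start at \<open>1\<close>; sequences are indexed from \<open>0\<close>.\<close>

definition weakly_stable_along_density_one :: "('a::complex_inner \<Rightarrow>\<^sub>L 'a) \<Rightarrow> bool" where
  "weakly_stable_along_density_one T \<longleftrightarrow>
     (\<exists>n :: nat \<Rightarrow> nat. (\<forall>j. 1 \<le> n j) \<and> strict_mono n \<and> has_density (range n) 1 \<and>
        limitin weak_operator_topology (\<lambda>j. power_op T (n j)) 0 sequentially)"

definition strong_limit_points_of_powers :: "complex set \<Rightarrow> ('a::complex_inner \<Rightarrow>\<^sub>L 'a) \<Rightarrow> bool" where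
  "strong_limit_points_of_powers \<Lambda> T \<longleftrightarrow>
     (\<forall>l\<in>\<Lambda>. \<exists>n :: nat \<Rightarrow> nat. (\<forall>j. 1 \<le> n j) \<and> filterlim n at_top sequentially \<and>
        limitin strong_operator_topology (\<lambda>j. power_op T (n j)) (scalar_op l) sequentially)"

end

theory Submission
  imports Defs
begin

text \<open>
  A set is residual as soon as it contains the intersection of countably many dense open sets, so
  the two properties have to be expressed by countably many open conditions, each of which has to
  be shown to hold densely.

  Everything is formulated on isometries with the strong topology. Property (2) follows if for
  every \<open>\<lambda> \<in> \<Lambda>\<close> and every \<open>j\<close> some power \<open>T\<^sup>n\<close>, \<open>n > j\<close>, is close to \<open>\<lambda>\<close> on the first \<open>j + 1\<close>
  members of a dense sequence, which is an open condition on \<open>T\<close>. Property (1) is the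
  convergence to zero of the means of \<open>\<bar>\<langle>T\<^sup>n x, y\<rangle>\<bar>\<^sup>2\<close>, turned into convergence along a set of density one by
  the Koopman-von Neumann argument (\<open>joint_convergence_along_density_one\<close>). Convergence of means
  looks like a condition on all large \<open>N\<close>, but the suprema
  over the unit ball of the sums \<open>\<Sum>\<^bsub>n \<le> N\<^esub> \<bar>\<langle>T\<^sup>n x, y\<rangle>\<bar>\<^sup>2\<close> are subadditive in \<open>N\<close>
  (\<open>small_mean_eventually\<close>), so that a single \<open>N\<close> with a small mean, uniformly in \<open>y\<close>, is enough,
  and this is again an open condition.

  On isometries the weak and the strong operator topology agree, on unitaries
  all three do. The isometries are a \<open>G\<^sub>\<delta>\<close> subset of the contractions, because the norm is weakly
  lower semicontinuous, and the unitaries are weakly dense in the contractions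
  (\<open>unitary_agreeing_weakly_with_contraction\<close>). Hence it suffices that the unitary operators
  satisfying one condition approximate every isometry strongly
  (\<open>residual_of_countably_many_strongly_open_dense\<close>).

  In the proof of density two elementary facts take the place of spectral theory: every positive
  semidefinite form on finitely many vectors is the Gram matrix of vectors in an infinite-dimensional space, orthogonal
  to any prescribed finite set (\<open>Gram_realization\<close>), and finite families with the same Gram matrix
  are carried to each other by a unitary operator of the whole space
  (\<open>unitary_between_families\<close>). With their help an isometry is approximated on a finite set of
  vectors by a multiple of a long cyclic shift, in which each of these vectors is spread over
  comparatively few consecutive positions (\<open>approximation_by_cyclic_shift\<close>). The full turn of
  the shift is a prescribed scalar \<open>\<lambda>\<close> on the shifted subspace, while the iterates before its completion are
  almost orthogonal on average. So one construction serves both properties.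
\<close>

section \<open>Complex inner products and adjoints\<close>

lemma cinner_add_right: "cinner x (y + z) = cinner x y + cinner x (z :: 'a::complex_inner)"
  by (metis cinner_commute cinner_add_left complex_cnj_add)

lemma cinner_scaleC_right: "cinner x (a *\<^sub>C y) = cnj a * cinner x (y :: 'a::complex_inner)"
  by (metis cinner_commute cinner_scaleC_left complex_cnj_mult)

lemma cinner_zero_left [simp]: "cinner 0 (y :: 'a::complex_inner) = 0"
  using cinner_add_left[of 0 0 y] by simp

lemma cinner_zero_right [simp]: "cinner (x :: 'a::complex_inner) 0 = 0"
  using cinner_add_right[of x 0 0] by simp

lemma cinner_minus_left: "cinner (- x) (y :: 'a::complex_inner) = - cinner x y"
  using cinner_add_left[of x "- x" y] by (simp add: eq_neg_iff_add_eq_0 add.commute)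

lemma cinner_minus_right: "cinner x (- y :: 'a::complex_inner) = - cinner x y"
  using cinner_add_right[of x y "- y"] by (simp add: eq_neg_iff_add_eq_0 add.commute)

lemma cinner_diff_left: "cinner (x - y) (z :: 'a::complex_inner) = cinner x z - cinner y z"
  using cinner_add_left[of x "- y" z] by (simp add: cinner_minus_left)

lemma cinner_diff_right: "cinner x (y - z :: 'a::complex_inner) = cinner x y - cinner x z"
  using cinner_add_right[of x y "- z"] by (simp add: cinner_minus_right)

lemma cinner_sum_left: "cinner (\<Sum>i\<in>I. f i) (y :: 'a::complex_inner) = (\<Sum>i\<in>I. cinner (f i) y)"
  by (induction I rule: infinite_finite_induct) (auto simp: cinner_add_left)

lemma cinner_sum_right: "cinner y (\<Sum>i\<in>I. f i :: 'a::complex_inner) = (\<Sum>i\<in>I. cinner y (f i))"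
  by (induction I rule: infinite_finite_induct) (auto simp: cinner_add_right)

lemma scaleC_zero_right [simp]: "c *\<^sub>C (0 :: 'a::complex_vector) = 0"
  using scaleC_add_right[of c 0 "0 :: 'a"] by simp

lemma scaleC_zero_left [simp]: "0 *\<^sub>C (x :: 'a::complex_vector) = 0"
  using scaleC_add_left[of 0 0 x] by simp

lemma scaleC_diff_right: "c *\<^sub>C (x - y :: 'a::complex_vector) = c *\<^sub>C x - c *\<^sub>C y"
  using scaleC_add_right[of c "x - y" y] by (simp add: algebra_simps)

lemma scaleC_scaleR: "c *\<^sub>C (r *\<^sub>R (x :: 'a::complex_vector)) = r *\<^sub>R (c *\<^sub>C x)"
  by (simp add: scaleR_scaleC scaleC_scaleC mult.commute)

lemma scaleC_sum_right: "c *\<^sub>C (\<Sum>i\<in>I. f i :: 'a::complex_vector) = (\<Sum>i\<in>I. c *\<^sub>C f i)"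
  by (induction I rule: infinite_finite_induct) (auto simp: scaleC_add_right)

lemma Im_cinner: "Im (cinner x (y :: 'a::complex_inner)) = - inner (\<i> *\<^sub>C x) y"
  by (simp add: inner_eq_Re_cinner cinner_scaleC_left)

lemma cinner_eqI:
  assumes "\<And>z. cinner z x = cinner z (y :: 'a::complex_inner)"
  shows "x = y"
  using assms by (metis inner_eq_Re_cinner vector_eq_ldot)

lemma cmod_cinner_le: "cmod (cinner x y) \<le> norm x * norm (y :: 'a::complex_inner)"
proof (cases "cinner x y = 0")
  case False
  define c where "c = cnj (cinner x y) / cmod (cinner x y)"
  have c: "cmod c = 1"
    using False by (simp add: c_def norm_divide)
  have "cnj (cinner x y) * cinner x y = complex_of_real ((cmod (cinner x y))\<^sup>2)"
    by (metis complex_norm_square mult.commute)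
  then have "c * cinner x y = cmod (cinner x y)"
    using False by (simp add: c_def power2_eq_square)
  then have "cmod (cinner x y) = inner (c *\<^sub>C x) y"
    by (simp add: inner_eq_Re_cinner cinner_scaleC_left)
  also have "\<dots> \<le> norm (c *\<^sub>C x) * norm y"
    by (rule norm_cauchy_schwarz)
  finally show ?thesis
    by (simp add: norm_scaleC c)
qed simp

lemma norm_eqI:
  assumes "cinner x x = cinner y y"
  shows "norm (x :: 'a::complex_inner) = norm (y :: 'b::complex_inner)"
  using assms by (simp add: norm_eq_sqrt_cinner)

lemma bounded_operators_scaleC:
  "T \<in> bounded_operators \<Longrightarrow> blinfun_apply T (c *\<^sub>C x) = c *\<^sub>C blinfun_apply T x"
  by (simp add: bounded_operators_def)

lemma bounded_operators_compose:
  "S \<in> bounded_operators \<Longrightarrow> T \<in> bounded_operators \<Longrightarrow> S o\<^sub>L T \<in> bounded_operators"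
  by (simp add: bounded_operators_def)

lemma bounded_operators_zero: "0 \<in> bounded_operators"
  by (simp add: bounded_operators_def)

lemma bounded_operators_power:
  "T \<in> bounded_operators \<Longrightarrow> power_op T n \<in> bounded_operators"
  by (induction n) (simp_all add: bounded_operators_compose, simp add: bounded_operators_def)

text \<open>A bounded functional \<open>\<phi>\<close> is represented by the minimizer of
  \<open>\<parallel>x\<parallel>\<^sup>2 - 2 \<phi>(x)\<close>: the parallelogram law makes every minimizing sequence a Cauchy sequence,
  and the vanishing first variation at the limit is the representation.\<close>

lemma Riesz_representation:
  fixes \<phi> :: "'a::{real_inner,complete_space} \<Rightarrow> real"
  assumes "bounded_linear \<phi>"
  shows "\<exists>v. \<forall>x. \<phi> x = inner x v"
proof -
  interpret bounded_linear \<phi> by fact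
  obtain K where K: "\<And>x. norm (\<phi> x) \<le> norm x * K"
    using bounded by blast
  define J where "J x = (norm x)\<^sup>2 - 2 * \<phi> x" for x
  have "J x \<ge> - K\<^sup>2" for x
  proof -
    have "\<phi> x \<le> norm x * K"
      using K[of x] by simp
    moreover have "0 \<le> (norm x - K)\<^sup>2"
      by simp
    ultimately show ?thesis
      by (simp add: J_def power2_diff mult.commute)
  qed
  then have bdd: "bdd_below (range J)"
    by (intro bdd_belowI[where m="- K\<^sup>2"]) auto
  define s where "s = Inf (range J)"
  have s: "s \<le> J x" for x
    unfolding s_def by (rule cInf_lower) (use bdd in auto)
  have "\<exists>x. J x < s + 1 / real (Suc n)" for n
  proof -
    have "Inf (range J) < s + 1 / real (Suc n)"
      by (simp add: s_def)
    then obtain y where "y \<in> range J" "y < s + 1 / real (Suc n)"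
      using cInf_lessD[of "range J"] by blast
    then show ?thesis by blast
  qed
  then obtain X where X: "\<And>n. J (X n) < s + 1 / real (Suc n)"
    by metis
  have par: "(norm (x - y))\<^sup>2 = 2 * J x + 2 * J y - 4 * J ((1/2) *\<^sub>R (x + y))" for x y
    by (simp add: J_def power2_norm_eq_inner scaleR add inner_simps inner_commute algebra_simps)
  have le: "(norm (X m - X n))\<^sup>2 \<le> 2 * (1 / real (Suc m)) + 2 * (1 / real (Suc n))" for m n
    using par[of "X m" "X n"] X[of m] X[of n] s[of "(1/2) *\<^sub>R (X m + X n)"] by linarith
  have "Cauchy X"
  proof (rule metric_CauchyI)
    fix e :: real assume "0 < e"
    then obtain N where N: "1 / real (Suc N) < e\<^sup>2 / 4"
      using nat_approx_posE[of "e\<^sup>2 / 4"] by auto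
    show "\<exists>M. \<forall>m\<ge>M. \<forall>n\<ge>M. dist (X m) (X n) < e"
    proof (intro exI allI impI)
      fix m n assume "m \<ge> N" "n \<ge> N"
      then have "1 / real (Suc m) \<le> 1 / real (Suc N)" "1 / real (Suc n) \<le> 1 / real (Suc N)"
        by (auto intro!: divide_left_mono)
      then have "(norm (X m - X n))\<^sup>2 < e\<^sup>2"
        using le[of m n] N by linarith
      then show "dist (X m) (X n) < e"
        using \<open>0 < e\<close> by (simp add: dist_norm power2_less_imp_less)
    qed
  qed
  then obtain v where v: "X \<longlonglongrightarrow> v"
    using Cauchy_convergent_iff convergent_def by blast
  have Jv: "(\<lambda>n. J (X n)) \<longlonglongrightarrow> J v"
    unfolding J_def by (intro tendsto_intros tendsto v)
  have "(\<lambda>n. s + 1 / real (Suc n)) \<longlonglongrightarrow> s + 0"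
    by (intro tendsto_intros LIMSEQ_Suc[OF lim_1_over_n])
  then have "J v \<le> s"
    using LIMSEQ_le[OF Jv, of "\<lambda>n. s + 1 / real (Suc n)" "s + 0"] X less_imp_le by auto
  then have min: "J v \<le> J x" for x
    using s[of x] by simp
  have "\<phi> w = inner w v" for w
  proof (rule ccontr)
    assume "\<phi> w \<noteq> inner w v"
    then have w: "w \<noteq> 0" by (auto simp: zero)
    define d where "d = \<phi> w - inner w v"
    define t where "t = d / (norm w)\<^sup>2"
    have "J (v + t *\<^sub>R w) = J v - 2 * t * d + t\<^sup>2 * (norm w)\<^sup>2"
      by (simp add: J_def d_def power2_norm_eq_inner add scaleR inner_simps inner_commute
          algebra_simps power2_eq_square[of t])
    also have "\<dots> = J v - d\<^sup>2 / (norm w)\<^sup>2"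
      using w by (simp add: t_def field_simps power2_eq_square)
    finally have "d\<^sup>2 / (norm w)\<^sup>2 \<le> 0"
      using min[of "v + t *\<^sub>R w"] by linarith
    moreover have "0 < d\<^sup>2 / (norm w)\<^sup>2"
      using w \<open>\<phi> w \<noteq> inner w v\<close> by (simp add: d_def)
    ultimately show False by simp
  qed
  then show ?thesis by blast
qed

lemma cinner_adjoint:
  fixes T :: "'a::complex_hilbert_space \<Rightarrow>\<^sub>L 'a"
  assumes "T \<in> bounded_operators"
  shows "cinner (blinfun_apply T x) y = cinner x (blinfun_apply (adjoint_op T) y)"
proof -
  have "\<exists>v. \<forall>x. inner (blinfun_apply T x) y = inner x v" for y
    by (rule Riesz_representation)
      (intro bounded_linear_compose[OF bounded_linear_inner_left] blinfun.bounded_linear_right)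
  then obtain S where S: "\<And>x y. inner (blinfun_apply T x) y = inner x (S y)"
    by metis
  have "bounded_linear S"
  proof (rule bounded_linear_intro)
    show "S (x + y) = S x + S y" for x y
      by (rule vector_eq_ldot[THEN iffD1]) (simp add: S[symmetric] inner_add_right)
    show "S (r *\<^sub>R x) = r *\<^sub>R S x" for r x
      by (rule vector_eq_ldot[THEN iffD1]) (simp add: S[symmetric])
    show "norm (S y) \<le> norm y * norm T" for y
    proof (cases "S y = 0")
      case False
      have "norm (S y) * norm (S y) = inner (blinfun_apply T (S y)) y"
        by (simp add: S flip: power2_norm_eq_inner power2_eq_square)
      also have "\<dots> \<le> norm (blinfun_apply T (S y)) * norm y"
        by (rule norm_cauchy_schwarz)
      also have "\<dots> \<le> norm T * norm (S y) * norm y"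
        by (intro mult_right_mono norm_blinfun) simp
      finally show ?thesis
        using False by (simp add: mult.commute mult.left_commute)
    qed simp
  qed
  then have ap: "blinfun_apply (Blinfun S) = S"
    by (rule bounded_linear_Blinfun_apply)
  have "cinner (blinfun_apply T x) y = cinner x (blinfun_apply (Blinfun S) y)" for x y
    using S[of x y] S[of "\<i> *\<^sub>C x" y] bounded_operators_scaleC[OF assms]
    by (simp add: complex_eq_iff Im_cinner ap inner_eq_Re_cinner[symmetric])
  then show ?thesis
    using adjoint_op_eqI by metis
qed

lemma adjoint_op_diff:
  fixes T :: "'a::complex_hilbert_space \<Rightarrow>\<^sub>L 'a"
  assumes "S \<in> bounded_operators" "T \<in> bounded_operators"
  shows "adjoint_op (S - T) = adjoint_op S - adjoint_op T"
  by (rule adjoint_op_eqI)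
    (simp add: blinfun.diff_left cinner_diff_left cinner_diff_right cinner_adjoint assms)

lemma isometriesD:
  assumes "T \<in> isometries"
  shows "T \<in> bounded_operators" "norm (blinfun_apply T x) = norm x"
  using assms by (auto simp: isometries_def)

text \<open>By polarization.\<close>

lemma cinner_isometry:
  assumes "T \<in> isometries"
  shows "cinner (blinfun_apply T x) (blinfun_apply T y) = cinner x y"
proof -
  have re: "inner (blinfun_apply T x) (blinfun_apply T y) = inner x y" for x y
    using isometriesD(2)[OF assms, of "x + y"] isometriesD(2)[OF assms, of x]
      isometriesD(2)[OF assms, of y]
    by (simp add: norm_eq inner_simps inner_commute blinfun.add_right)
  show ?thesis
    using re[of x y] re[of "\<i> *\<^sub>C x" y] bounded_operators_scaleC[OF isometriesD(1)[OF assms]]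
    by (simp add: complex_eq_iff Im_cinner inner_eq_Re_cinner[symmetric])
qed

lemma unitaries_eq:
  "unitaries = {T \<in> isometries :: ('a::complex_hilbert_space \<Rightarrow>\<^sub>L 'a) set.
     surj (blinfun_apply T)}"
proof (intro equalityI subsetI)
  fix T :: "'a \<Rightarrow>\<^sub>L 'a" assume "T \<in> unitaries"
  then have T: "T \<in> bounded_operators" and 1: "adjoint_op T o\<^sub>L T = id_blinfun"
    and 2: "T o\<^sub>L adjoint_op T = id_blinfun"
    by (auto simp: unitaries_def)
  have "blinfun_apply (adjoint_op T) (blinfun_apply T x) = x" for x
    using arg_cong[OF 1, of "\<lambda>S. blinfun_apply S x"] by simp
  then have "norm (blinfun_apply T x) = norm x" for x
    by (intro norm_eqI) (simp add: cinner_adjoint[OF T])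
  moreover have "blinfun_apply T (blinfun_apply (adjoint_op T) x) = x" for x
    using arg_cong[OF 2, of "\<lambda>S. blinfun_apply S x"] by simp
  then have "surj (blinfun_apply T)"
    by (metis surjI)
  ultimately show "T \<in> {T \<in> isometries. surj (blinfun_apply T)}"
    using T by (simp add: isometries_def)
next
  fix T :: "'a \<Rightarrow>\<^sub>L 'a" assume "T \<in> {T \<in> isometries. surj (blinfun_apply T)}"
  then have iso: "T \<in> isometries" and surj: "surj (blinfun_apply T)"
    by auto
  note T = isometriesD(1)[OF iso]
  have 1: "blinfun_apply (adjoint_op T) (blinfun_apply T x) = x" for x
    by (rule cinner_eqI) (simp add: cinner_adjoint[OF T, symmetric] cinner_isometry[OF iso])
  moreover have "blinfun_apply T (blinfun_apply (adjoint_op T) y) = y" for y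
    using 1 surj by (metis surjD)
  ultimately show "T \<in> unitaries"
    using T by (auto simp: unitaries_def intro!: blinfun_eqI)
qed

lemma isometries_compose: "S \<in> isometries \<Longrightarrow> T \<in> isometries \<Longrightarrow> S o\<^sub>L T \<in> isometries"
  by (simp add: isometries_def bounded_operators_compose)

lemma unitaries_compose:
  "S \<in> unitaries \<Longrightarrow> T \<in> unitaries \<Longrightarrow> S o\<^sub>L T \<in> (unitaries :: ('a::complex_hilbert_space \<Rightarrow>\<^sub>L 'a) set)"
  using comp_surj[of "blinfun_apply T" "blinfun_apply S"]
  by (simp add: unitaries_eq isometries_compose comp_def)

lemma unitaries_id: "id_blinfun \<in> (unitaries :: ('a::complex_hilbert_space \<Rightarrow>\<^sub>L 'a) set)"
  by (auto simp: unitaries_eq isometries_def bounded_operators_def intro!: surjI[of _ id])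

lemma norm_power_op_le:
  assumes "norm T \<le> 1"
  shows "norm (blinfun_apply (power_op T n) x) \<le> norm x"
proof (induction n)
  case (Suc n)
  have "norm (blinfun_apply T (blinfun_apply (power_op T n) x)) \<le>
      1 * norm (blinfun_apply (power_op T n) x)"
    using norm_blinfun assms by (meson mult_right_mono norm_ge_zero order_trans)
  with Suc show ?case by simp
qed simp

lemma isometries_subset_contractions: "isometries \<subseteq> contractions"
  by (auto simp: isometries_def contractions_def intro!: norm_blinfun_bound)

lemma power_op_isometry: "T \<in> isometries \<Longrightarrow> power_op T n \<in> isometries"
  by (induction n) (simp_all add: isometries_compose, simp add: isometries_def bounded_operators_def)

lemma power_op_add: "power_op T (m + n) = power_op T m o\<^sub>L power_op T n"
  by (induction m) (auto intro: blinfun_eqI)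

section \<open>Realizing Gram matrices\<close>

definition psd_form :: "('b::complex_vector \<Rightarrow> 'b \<Rightarrow> complex) \<Rightarrow> bool" where
  "psd_form B \<longleftrightarrow>
     (\<forall>x y z. B (x + y) z = B x z + B y z) \<and> (\<forall>c x y. B (c *\<^sub>C x) y = c * B x y) \<and>
     (\<forall>x y. B x y = cnj (B y x)) \<and> (\<forall>x. 0 \<le> Re (B x x))"

lemma psd_form_cinner: "psd_form (cinner :: 'a::complex_inner \<Rightarrow> _)"
  unfolding psd_form_def
  using cinner_add_left cinner_scaleC_left cinner_commute by (auto simp: cinner_self)

lemma psd_form_self_real:
  assumes "psd_form B"
  shows "B x x = complex_of_real (Re (B x x))"
proof -
  have "B x x = cnj (B x x)"
    using assms unfolding psd_form_def by blast
  then show ?thesis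
    by (metis Reals_cnj_iff of_real_Re)
qed

lemma psd_form_Cauchy_Schwarz:
  assumes "psd_form B"
  shows "(cmod (B x y))\<^sup>2 \<le> Re (B x x) * Re (B y y)"
proof -
  define b where "b = Re (B y y)"
  have add: "B (x + y) z = B x z + B y z" and scale: "B (c *\<^sub>C x) y = c * B x y"
    and comm: "B x y = cnj (B y x)" and pos: "0 \<le> Re (B x x)" for x y z c
    using assms unfolding psd_form_def by blast+
  have addr: "B z (x + y) = B z x + B z y" and scaler: "B x (c *\<^sub>C y) = cnj c * B x y" for x y z c
    using add[of x y z] scale[of c y x] comm[of z] comm[of _ z] comm[of x] comm[of _ x]
    by (metis complex_cnj_add, metis complex_cnj_mult)
  have *: "0 \<le> Re (B x x) - 2 * t * (cmod (B x y))\<^sup>2 + t\<^sup>2 * (cmod (B x y))\<^sup>2 * b" for t :: real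
  proof -
    define c where "c = - complex_of_real t * B x y"
    have "B (x + c *\<^sub>C y) (x + c *\<^sub>C y) = B x x + cnj c * B x y + c * cnj (B x y) + c * cnj c * B y y"
      by (simp add: add addr scale scaler comm[of y x] algebra_simps)
    also have "cnj c * B x y = complex_of_real (- t * (cmod (B x y))\<^sup>2)"
      using complex_norm_square[of "B x y"] by (simp add: c_def mult.commute)
    also have "c * cnj (B x y) = complex_of_real (- t * (cmod (B x y))\<^sup>2)"
      using complex_norm_square[of "B x y"] by (simp add: c_def)
    also have "c * cnj c = complex_of_real (t\<^sup>2 * (cmod (B x y))\<^sup>2)"
      using complex_norm_square[of "B x y"] by (simp add: c_def power2_eq_square)
    finally show ?thesis
      using pos[of "x + c *\<^sub>C y"] by (simp add: b_def)
  qed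
  have "b \<ge> 0"
    using pos by (simp add: b_def)
  show ?thesis
  proof (cases "b = 0")
    case True
    have "B x y = 0"
    proof (rule ccontr)
      assume "B x y \<noteq> 0"
      then show False
        using *[of "(Re (B x x) + 1) / (2 * (cmod (B x y))\<^sup>2)"] True by (simp add: field_simps)
    qed
    then show ?thesis
      using True by (simp add: b_def)
  next
    case False
    then have "0 \<le> Re (B x x) - (cmod (B x y))\<^sup>2 / b"
      using *[of "1 / b"] by (simp add: power2_eq_square field_simps)
    then show ?thesis
      using False \<open>b \<ge> 0\<close> by (simp add: field_simps flip: b_def)
  qed
qed

lemma finite_orthogonal_projection:
  fixes A :: "'a::complex_inner set"
  assumes "finite A"
  shows "\<exists>p\<in>complex_vector.span A. \<forall>a\<in>A. cinner (x - p) a = 0"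
  using assms
proof (induction A arbitrary: x rule: finite_induct)
  case (insert a A)
  obtain q where q: "q \<in> complex_vector.span A" "\<And>b. b \<in> A \<Longrightarrow> cinner (a - q) b = 0"
    using insert.IH by blast
  obtain p where p: "p \<in> complex_vector.span A" "\<And>b. b \<in> A \<Longrightarrow> cinner (x - p) b = 0"
    using insert.IH by blast
  have sub: "complex_vector.span A \<subseteq> complex_vector.span (insert a A)"
    by (intro complex_vector.span_mono) auto
  \<comment> \<open>If \<open>a\<close> lies in the span, then \<open>c\<close> is \<open>0\<close> by the convention for division.\<close>
  define c where "c = cinner (x - p) (a - q) / cinner (a - q) (a - q)"
  have orth: "cinner z b = 0" if "b \<in> complex_vector.span A" "\<And>b. b \<in> A \<Longrightarrow> cinner z b = 0" for z b
    using that(1)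
    by (rule complex_vector.span_induct_alt)
      (auto simp: cinner_add_right cinner_scaleC_right that(2))
  have "cinner (x - p) (a - q) = c * cinner (a - q) (a - q)"
    by (cases "a = q") (auto simp: c_def cinner_self)
  then have "cinner (x - p - c *\<^sub>C (a - q)) (a - q) = 0"
    by (simp add: cinner_diff_left cinner_scaleC_left)
  moreover have A: "cinner (x - p - c *\<^sub>C (a - q)) b = 0" if "b \<in> A" for b
    using p(2)[OF that] q(2)[OF that]
    by (subst cinner_diff_left) (simp only: cinner_scaleC_left, simp)
  ultimately have "cinner (x - p - c *\<^sub>C (a - q)) (a - q + q) = 0"
    by (subst cinner_add_right) (simp add: orth[OF q(1)])
  with A have "\<forall>b\<in>insert a A. cinner (x - (p + c *\<^sub>C (a - q))) b = 0"
    by (simp add: diff_diff_eq)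
  moreover have "p + c *\<^sub>C (a - q) \<in> complex_vector.span (insert a A)"
    using p(1) q(1) sub
    by (intro complex_vector.span_add complex_vector.span_scale complex_vector.span_diff)
      (auto intro: complex_vector.span_base)
  ultimately show ?case
    by blast
qed (auto intro: complex_vector.span_zero)

lemma unit_vector_orthogonal_to_finite:
  fixes A :: "'a::complex_inner set"
  assumes "infinite_dimensional TYPE('a)" "finite A"
  shows "\<exists>e :: 'a. norm e = 1 \<and> (\<forall>a\<in>A. cinner e a = 0)"
proof -
  obtain x :: 'a where x: "x \<notin> complex_vector.span A"
    using assms unfolding infinite_dimensional_def by blast
  obtain p where p: "p \<in> complex_vector.span A" "\<forall>a\<in>A. cinner (x - p) a = 0"
    using finite_orthogonal_projection[OF assms(2)] by blast
  define e where "e = complex_of_real (1 / norm (x - p)) *\<^sub>C (x - p)"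
  have "x \<noteq> p"
    using x p(1) by auto
  then have "norm e = 1"
    by (simp add: e_def norm_scaleC norm_divide)
  then show ?thesis
    using p(2) by (auto simp: e_def cinner_scaleC_left)
qed

text \<open>Cholesky decomposition: the vector realizing \<open>x k\<close> is a multiple of a unit vector \<open>e\<close>
  orthogonal to everything else, which forces the \<open>e\<close>-components of all other vectors, and what
  remains to be realized orthogonally to \<open>e\<close> is the Schur complement \<open>B'\<close> of \<open>B\<close>. The Schur
  complement is positive by the Cauchy-Schwarz inequality.\<close>

lemma Gram_realization:
  fixes x :: "'i \<Rightarrow> 'b::complex_vector" and A :: "'a::complex_inner set"
  assumes "infinite_dimensional TYPE('a)" "finite I" "finite A" "psd_form B"
  shows "\<exists>v :: 'i \<Rightarrow> 'a. (\<forall>i\<in>I. \<forall>a\<in>A. cinner (v i) a = 0) \<and>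
    (\<forall>i\<in>I. \<forall>j\<in>I. cinner (v i) (v j) = B (x i) (x j))"
  using assms(2-4)
proof (induction I arbitrary: A B rule: finite_induct)
  case (insert k I)
  have add: "B (x + y) z = B x z + B y z" and scale: "B (c *\<^sub>C x) y = c * B x y"
    and comm: "B x y = cnj (B y x)" and pos: "0 \<le> Re (B x x)" for x y z c
    using insert.prems(2) unfolding psd_form_def by blast+
  define b where "b = Re (B (x k) (x k))"
  have b: "B (x k) (x k) = complex_of_real b" and b_nonneg: "0 \<le> b"
    using psd_form_self_real[OF insert.prems(2)] pos by (auto simp: b_def)
  show ?case
  proof (cases "b = 0")
    case True
    have "(cmod (B y (x k)))\<^sup>2 \<le> 0" for y
      using psd_form_Cauchy_Schwarz[OF insert.prems(2), of y "x k"] True by (simp add: b_def)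
    then have 0: "B y (x k) = 0" for y
      by simp
    moreover have "B (x k) y = 0" for y
      using comm[of "x k" y] 0[of y] by simp
    moreover obtain v :: "'i \<Rightarrow> 'a" where "\<forall>i\<in>I. \<forall>a\<in>A. cinner (v i) a = 0"
      "\<forall>i\<in>I. \<forall>j\<in>I. cinner (v i) (v j) = B (x i) (x j)"
      using insert.IH[OF insert.prems] by blast
    ultimately show ?thesis
      using insert.hyps by (intro exI[of _ "v(k := 0)"]) auto
  next
    case False
    with b_nonneg have "b > 0" by simp
    obtain e :: 'a where e: "norm e = 1" "\<And>a. a \<in> A \<Longrightarrow> cinner e a = 0"
      using unit_vector_orthogonal_to_finite[OF assms(1) insert.prems(1)] by blast
    define B' where "B' y z = B y z - B y (x k) * B (x k) z / b" for y z
    have "psd_form B'"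
      unfolding psd_form_def
    proof (intro conjI allI)
      show "B' (y + z) w = B' y w + B' z w" for y z w
        by (simp add: B'_def add algebra_simps add_divide_distrib)
      show "B' (c *\<^sub>C y) z = c * B' y z" for c y z
        by (simp add: B'_def scale algebra_simps)
      show "B' y z = cnj (B' z y)" for y z
        using comm[of y z] comm[of y "x k"] comm[of "x k" z] by (simp add: B'_def mult.commute)
      show "0 \<le> Re (B' y y)" for y
      proof -
        have "B y (x k) * B (x k) y = complex_of_real ((cmod (B y (x k)))\<^sup>2)"
          using comm[of "x k" y] complex_norm_square by simp
        then have "Re (B' y y) = Re (B y y) - (cmod (B y (x k)))\<^sup>2 / b"
          by (simp add: B'_def flip: of_real_divide)
        moreover have "(cmod (B y (x k)))\<^sup>2 / b \<le> Re (B y y)"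
          using psd_form_Cauchy_Schwarz[OF insert.prems(2), of y "x k"] \<open>b > 0\<close>
          by (simp add: field_simps flip: b_def)
        ultimately show ?thesis by simp
      qed
    qed
    then obtain v :: "'i \<Rightarrow> 'a" where v: "\<And>i a. i \<in> I \<Longrightarrow> a \<in> insert e A \<Longrightarrow> cinner (v i) a = 0"
      "\<And>i j. i \<in> I \<Longrightarrow> j \<in> I \<Longrightarrow> cinner (v i) (v j) = B' (x i) (x j)"
      using insert.IH[of "insert e A" B'] insert.prems(1) by blast
    have ev: "cinner e (v i) = 0" if "i \<in> I" for i
      using v(1)[OF that, of e] cinner_commute[of e "v i"] by simp
    have ee: "cinner e e = 1"
      using e by (simp add: cinner_self)
    have sq: "complex_of_real (sqrt b) * complex_of_real (sqrt b) = b"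
      using \<open>b > 0\<close> by (simp flip: of_real_mult)
    define w where "w i = (if i = k then sqrt b *\<^sub>C e else v i + (B (x i) (x k) / sqrt b) *\<^sub>C e)" for i
    have "cinner (w i) a = 0" if "i \<in> insert k I" "a \<in> A" for i a
      using that v(1) e(2) by (auto simp: w_def cinner_add_left cinner_scaleC_left)
    moreover have "cinner (w i) (w j) = B (x i) (x j)" if ij: "i \<in> insert k I" "j \<in> insert k I" for i j
    proof -
      consider "i = k" "j = k" | "i = k" "j \<in> I" "j \<noteq> k" | "i \<in> I" "i \<noteq> k" "j = k"
        | "i \<in> I" "j \<in> I" "i \<noteq> k" "j \<noteq> k"
        using ij by blast
      then show ?thesis
      proof cases
        case 1
        then show ?thesis
          using sq by (simp add: w_def cinner_scaleC_left cinner_scaleC_right ee b)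
      next
        case 2
        then show ?thesis
          using \<open>b > 0\<close> ev[of j] comm[of "x k" "x j"]
          by (simp add: w_def cinner_add_right cinner_scaleC_left cinner_scaleC_right ee)
      next
        case 3
        then show ?thesis
          using \<open>b > 0\<close> v(1)[of i e]
          by (simp add: w_def cinner_add_left cinner_scaleC_left cinner_scaleC_right ee)
      next
        case 4
        then have "cinner (w i) (w j) = B' (x i) (x j) + B (x i) (x k) * cnj (B (x j) (x k)) / b"
          using v(1)[of i e] ev[of j] v(2)[of i j] sq
          by (simp add: w_def cinner_add_left cinner_add_right cinner_scaleC_left
              cinner_scaleC_right ee)
        then show ?thesis
          using comm[of "x k" "x j"] by (simp add: B'_def)
      qed
    qed
    ultimately show ?thesis by blast
  qed
qed simp


section \<open>Extending isometries between finite families\<close>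

text \<open>A complex reflection in the direction of \<open>w = x - y\<close>. With \<open>\<beta> = 1 / \<langle>x, w\<rangle>\<close> the
  operator \<open>z \<mapsto> z - \<beta> \<langle>z, w\<rangle> w\<close> sends \<open>x\<close> to \<open>y\<close>; the equality of the norms gives
  \<open>2 Re \<langle>x, w\<rangle> = \<parallel>w\<parallel>\<^sup>2\<close>, which makes it isometric, with inverse given by \<open>cnj \<beta>\<close>.\<close>

lemma unitary_reflection:
  fixes x y :: "'a::complex_hilbert_space"
  assumes "norm x = norm y"
  shows "\<exists>Q\<in>unitaries. blinfun_apply Q x = y \<and>
    (\<forall>z. cinner z x = cinner z y \<longrightarrow> blinfun_apply Q z = z)"
proof (cases "x = y")
  case True
  then show ?thesis
    using unitaries_id by (intro bexI[of _ id_blinfun]) auto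
next
  case False
  define w where "w = x - y"
  define s where "s = cinner x w"
  define \<beta> where "\<beta> = 1 / s"
  have "(norm w)\<^sup>2 = 2 * (norm x)\<^sup>2 - 2 * inner x y"
    using assms by (simp add: w_def power2_norm_eq_inner inner_simps inner_commute norm_eq)
  then have re: "2 * Re s = (norm w)\<^sup>2"
    by (simp add: s_def w_def cinner_diff_right cinner_self inner_eq_Re_cinner)
  have "w \<noteq> 0"
    using False by (simp add: w_def)
  with re have s: "s \<noteq> 0" by auto
  have ss: "s + cnj s = (norm w)\<^sup>2"
    using re by (simp add: complex_eq_iff)
  have beta: "\<beta> + cnj \<beta> = \<beta> * cnj \<beta> * (norm w)\<^sup>2" "cnj \<beta> + \<beta> = \<beta> * cnj \<beta> * (norm w)\<^sup>2"
    using s unfolding ss[symmetric] by (auto simp: \<beta>_def field_simps)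
  define q where "q b z = z - (b * cinner z w) *\<^sub>C w" for b z
  have "bounded_linear (q \<beta>)"
  proof (rule bounded_linear_intro)
    show "q \<beta> (u + v) = q \<beta> u + q \<beta> v" for u v
      by (simp add: q_def cinner_add_left distrib_left scaleC_add_left)
    show "q \<beta> (r *\<^sub>R u) = r *\<^sub>R q \<beta> u" for r u
      by (simp add: q_def scaleR_scaleC cinner_scaleC_left scaleC_diff_right scaleC_scaleC
          mult.left_commute)
    show "norm (q \<beta> u) \<le> norm u * (1 + cmod \<beta> * norm w * norm w)" for u
    proof -
      have "norm (q \<beta> u) \<le> norm u + cmod \<beta> * cmod (cinner u w) * norm w"
        unfolding q_def by (rule order_trans[OF norm_triangle_ineq4]) (simp add: norm_scaleC norm_mult)
      also have "\<dots> \<le> norm u + cmod \<beta> * (norm u * norm w) * norm w"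
        by (intro add_left_mono mult_right_mono mult_left_mono cmod_cinner_le) auto
      finally show ?thesis
        by (simp add: algebra_simps)
    qed
  qed
  then have ap: "blinfun_apply (Blinfun (q \<beta>)) = q \<beta>"
    by (rule bounded_linear_Blinfun_apply)
  have inv: "q \<beta> (q (cnj \<beta>) z) = z" for z
  proof -
    have "q \<beta> (q (cnj \<beta>) z) =
        z - ((\<beta> + cnj \<beta> - \<beta> * cnj \<beta> * (norm w)\<^sup>2) * cinner z w) *\<^sub>C w"
      by (simp add: q_def cinner_diff_left cinner_scaleC_left cinner_self algebra_simps
          complex_vector.scale_left_diff_distrib scaleC_add_left)
    then show ?thesis
      using beta by simp
  qed
  have "norm (q \<beta> z) = norm z" for z
  proof (rule norm_eqI)
    have "cinner (q \<beta> z) (q \<beta> z) =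
        cinner z z - (\<beta> + cnj \<beta> - \<beta> * cnj \<beta> * (norm w)\<^sup>2) * (cinner z w * cnj (cinner z w))"
      by (simp add: q_def cinner_diff_left cinner_diff_right cinner_scaleC_left
          cinner_scaleC_right cinner_self[of w] cinner_commute[of w z] algebra_simps)
    then show "cinner (q \<beta> z) (q \<beta> z) = cinner z z"
      using beta by simp
  qed
  moreover have "q \<beta> (c *\<^sub>C z) = c *\<^sub>C q \<beta> z" for c z
    by (simp add: q_def cinner_scaleC_left scaleC_diff_right scaleC_scaleC mult.left_commute)
  moreover have "surj (q \<beta>)"
    using inv by (rule surjI)
  ultimately have "Blinfun (q \<beta>) \<in> unitaries"
    by (simp add: unitaries_eq isometries_def bounded_operators_def ap)
  moreover have "q \<beta> x = y"
    using s by (simp add: q_def \<beta>_def scaleC_one flip: s_def) (simp add: w_def)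
  moreover have "q \<beta> z = z" if "cinner z x = cinner z y" for z
    using that by (simp add: q_def w_def cinner_diff_right)
  ultimately show ?thesis
    using ap by metis
qed

text \<open>Families with the same Gram matrix are unitarily equivalent. Once the images of the first
  vectors are right, the reflection that corrects the image of the next one fixes all of them.\<close>

lemma unitary_between_families:
  fixes x y :: "'i \<Rightarrow> 'a::complex_hilbert_space"
  assumes "finite I" "\<And>i j. i \<in> I \<Longrightarrow> j \<in> I \<Longrightarrow> cinner (x i) (x j) = cinner (y i) (y j)"
  shows "\<exists>R\<in>unitaries. \<forall>i\<in>I. blinfun_apply R (x i) = y i"
  using assms
proof (induction I rule: finite_induct)
  case empty
  then show ?case
    using unitaries_id by blast
next
  case (insert k I)
  then obtain R where R: "R \<in> unitaries" "\<And>i. i \<in> I \<Longrightarrow> blinfun_apply R (x i) = y i"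
    by auto
  have iso: "R \<in> isometries"
    using R by (simp add: unitaries_eq)
  have "norm (blinfun_apply R (x k)) = norm (x k)"
    using iso by (simp add: isometriesD)
  also have "\<dots> = norm (y k)"
    using insert.prems by (intro norm_eqI) auto
  finally obtain Q where Q: "Q \<in> unitaries" "blinfun_apply Q (blinfun_apply R (x k)) = y k"
    "\<And>z. cinner z (blinfun_apply R (x k)) = cinner z (y k) \<Longrightarrow> blinfun_apply Q z = z"
    using unitary_reflection by metis
  have "blinfun_apply Q (y i) = y i" if "i \<in> I" for i
  proof (rule Q(3))
    have "cinner (y i) (blinfun_apply R (x k)) = cinner (x i) (x k)"
      using R(2)[OF that] cinner_isometry[OF iso] by metis
    then show "cinner (y i) (blinfun_apply R (x k)) = cinner (y i) (y k)"
      using insert.prems that by simp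
  qed
  then have "\<forall>i\<in>insert k I. blinfun_apply (Q o\<^sub>L R) (x i) = y i"
    using Q(2) R(2) by auto
  then show ?case
    using unitaries_compose[OF Q(1) R(1)] by blast
qed

lemma orthogonal_copies:
  fixes x :: "'i \<Rightarrow> 'a::complex_inner"
  assumes "infinite_dimensional TYPE('a)" "finite I"
  shows "\<exists>v :: 'i \<Rightarrow> nat \<Rightarrow> 'a. \<forall>i\<in>I. \<forall>j\<in>I. \<forall>k<M. \<forall>l<M.
    cinner (v i k) (v j l) = (if k = l then cinner (x i) (x j) else 0)"
proof (induction M)
  case (Suc M)
  then obtain v :: "'i \<Rightarrow> nat \<Rightarrow> 'a" where v: "\<And>i j k l. i \<in> I \<Longrightarrow> j \<in> I \<Longrightarrow> k < M \<Longrightarrow> l < M \<Longrightarrow>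
    cinner (v i k) (v j l) = (if k = l then cinner (x i) (x j) else 0)"
    by metis
  have "finite (case_prod v ` (I \<times> {..<M}))"
    using assms(2) by simp
  then obtain u :: "'i \<Rightarrow> 'a" where u: "\<And>i a. i \<in> I \<Longrightarrow> a \<in> case_prod v ` (I \<times> {..<M}) \<Longrightarrow> cinner (u i) a = 0"
    "\<And>i j. i \<in> I \<Longrightarrow> j \<in> I \<Longrightarrow> cinner (u i) (u j) = cinner (x i) (x j)"
    using Gram_realization[OF assms(1,2) _ psd_form_cinner] by metis
  have uv: "cinner (u i) (v j l) = 0" "cinner (v j l) (u i) = 0" if "i \<in> I" "j \<in> I" "l < M" for i j l
    using u(1)[OF that(1), of "v j l"] that cinner_commute[of "v j l" "u i"] by force+
  show ?case
    by (intro exI[of _ "\<lambda>i k. if k = M then u i else v i k"]) (auto simp: less_Suc_eq u(2) v uv)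
qed simp

section \<open>Approximation by cyclic shifts\<close>

lemma cinner_scaleR_left: "cinner (r *\<^sub>R x) (y :: 'a::complex_inner) = r * cinner x y"
  by (simp add: scaleR_scaleC cinner_scaleC_left)

lemma cinner_scaleR_right: "cinner x (r *\<^sub>R y :: 'a::complex_inner) = r * cinner x y"
  by (simp add: scaleR_scaleC cinner_scaleC_right)

lemma Bessel_inequality:
  fixes e :: "'i \<Rightarrow> 'a::complex_inner"
  assumes "finite J" "\<And>i j. i \<in> J \<Longrightarrow> j \<in> J \<Longrightarrow> cinner (e i) (e j) = (if i = j then complex_of_real r else 0)"
    and "0 \<le> r"
  shows "(\<Sum>i\<in>J. (cmod (cinner (e i) y))\<^sup>2) \<le> r * (norm y)\<^sup>2"
proof (cases "r = 0")
  case True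
  then have "e i = 0" if "i \<in> J" for i
    using assms(2)[OF that that] by (simp add: cinner_self)
  then show ?thesis
    using True by simp
next
  case False
  define s where "s = (\<Sum>i\<in>J. (cmod (cinner (e i) y))\<^sup>2)"
  define p where "p = (\<Sum>i\<in>J. cinner y (e i) *\<^sub>C e i)"
  have sq: "cinner y (e i) * cinner (e i) y = (cmod (cinner (e i) y))\<^sup>2" for i
    using complex_norm_square[of "cinner (e i) y"] cinner_commute[of y "e i"] by (simp add: mult.commute)
  have py: "cinner p y = s" and yp: "cinner y p = s"
    using sq cinner_commute[of _ y]
    by (simp_all add: p_def s_def cinner_sum_left cinner_sum_right cinner_scaleC_left
        cinner_scaleC_right mult.commute)
  have "cinner p (e j) = cinner y (e j) * r" if "j \<in> J" for j
    using that assms(1)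
    by (simp add: p_def cinner_sum_left cinner_scaleC_left assms(2) if_distrib sum.delta cong: if_cong)
  then have "cinner p p = (\<Sum>j\<in>J. r * (cinner y (e j) * cinner (e j) y))"
    unfolding p_def[of] cinner_sum_right using cinner_commute[of _ y]
    by (intro sum.cong) (auto simp: cinner_scaleC_right p_def)
  then have pp: "cinner p p = r * s"
    by (simp add: sq s_def flip: sum_distrib_left)
  have "cinner (r *\<^sub>R y - p) (r *\<^sub>R y - p) = complex_of_real (r\<^sup>2 * (norm y)\<^sup>2 - r * s)"
    by (simp add: cinner_diff_left cinner_diff_right cinner_scaleR_left cinner_scaleR_right py yp pp
        cinner_self[of y] power2_eq_square algebra_simps)
  then have "(norm (r *\<^sub>R y - p))\<^sup>2 = r\<^sup>2 * (norm y)\<^sup>2 - r * s"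
    unfolding cinner_self of_real_eq_iff .
  then have "r * s \<le> r * (r * (norm y)\<^sup>2)"
    using zero_le_power2[of "norm (r *\<^sub>R y - p)"] by (simp add: power2_eq_square)
  then show ?thesis
    using False assms(3) by (simp add: s_def)
qed

lemma scalar_op_compose_isometry:
  assumes "T \<in> isometries" "cmod c = 1"
  shows "scalar_op c o\<^sub>L T \<in> isometries"
  using assms
  by (auto simp: isometries_def bounded_operators_def scalar_op.rep_eq norm_scaleC scaleC_scaleC mult.commute)

text \<open>The vector \<open>v x k l\<close> is a copy of \<open>T\<^sup>k x\<close> in level \<open>l\<close>. In the representations of \<open>x\<close> and \<open>T x\<close>
  the exponent of \<open>T\<close> decreases along the levels, and this is what makes moving up by one level almost
  the same as applying \<open>T\<close>. As \<open>T\<close> is isometric, the normalized sums of such copies have the same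
  Gram matrix as the vectors \<open>x\<close> and \<open>T x\<close>, and a unitary operator moves them there.\<close>

lemma orthogonal_levels:
  fixes T :: "'a::complex_hilbert_space \<Rightarrow>\<^sub>L 'a"
  assumes "infinite_dimensional TYPE('a)" "T \<in> isometries" "finite X" "0 < n" "n < M"
  obtains v :: "'a \<Rightarrow> nat \<Rightarrow> nat \<Rightarrow> 'a" where
    "\<And>x y j k l m. x \<in> X \<Longrightarrow> y \<in> X \<Longrightarrow> j \<le> n \<Longrightarrow> k \<le> n \<Longrightarrow> l < M \<Longrightarrow> m < M \<Longrightarrow>
       cinner (v x j l) (v y k m) =
       (if l = m then cinner (blinfun_apply (power_op T j) x) (blinfun_apply (power_op T k) y) else 0)"
    "\<And>x. x \<in> X \<Longrightarrow> x = (1 / sqrt n) *\<^sub>R (\<Sum>l<n. v x (n - 1 - l) l)"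
    "\<And>x. x \<in> X \<Longrightarrow> blinfun_apply T x = (1 / sqrt n) *\<^sub>R (\<Sum>l<n. v x (n - l) l)"
proof -
  define z where "z = (\<lambda>(x, k). blinfun_apply (power_op T k) x)"
  have "finite (X \<times> {..n})"
    using assms(3) by simp
  then obtain v' :: "'a \<times> nat \<Rightarrow> nat \<Rightarrow> 'a" where v': "\<And>i j l m. i \<in> X \<times> {..n} \<Longrightarrow> j \<in> X \<times> {..n} \<Longrightarrow> l < M \<Longrightarrow>
      m < M \<Longrightarrow> cinner (v' i l) (v' j m) = (if l = m then cinner (z i) (z j) else 0)"
    using orthogonal_copies[OF assms(1), of "X \<times> {..n}" M z] by metis
  define g where "g = (\<lambda>(x, a). (1 / sqrt n) *\<^sub>R (\<Sum>l<n. v' (x, n - 1 - l + a) l))"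
  define f where "f = (\<lambda>(x, a). blinfun_apply (power_op T a) x)"
  have z_add: "cinner (z (x, k + a)) (z (y, k + b)) = cinner (f (x, a)) (f (y, b))" for x y a b k
    by (simp add: z_def f_def power_op_add cinner_isometry[OF power_op_isometry[OF assms(2)]])
  have "cinner (g i) (g j) = cinner (f i) (f j)" if "i \<in> X \<times> {..1}" "j \<in> X \<times> {..1}" for i j
  proof -
    obtain x a y b where [simp]: "i = (x, a)" "j = (y, b)" and xy: "x \<in> X" "y \<in> X" "a \<le> 1" "b \<le> 1"
      using \<open>i \<in> X \<times> {..1}\<close> \<open>j \<in> X \<times> {..1}\<close> by auto
    have le: "n - 1 - l + a \<le> n" "n - 1 - l + b \<le> n" if "l < n" for l
      using that xy by auto
    have "cinner (v' (x, n - 1 - l + a) l) (v' (y, n - 1 - m + b) m) =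
        (if l = m then cinner (f (x, a)) (f (y, b)) else 0)" if "l < n" "m < n" for l m
      using v'[of "(x, n - 1 - l + a)" "(y, n - 1 - m + b)" l m] le[OF that(1)] le[OF that(2)] xy that
        \<open>n < M\<close> z_add[of x "n - 1 - l" a y b] by (auto simp del: diff_diff_left)
    then have "(\<Sum>l<n. \<Sum>m<n. cinner (v' (x, n - 1 - l + a) l) (v' (y, n - 1 - m + b) m)) =
        (\<Sum>l<n. \<Sum>m<n. if l = m then cinner (f (x, a)) (f (y, b)) else 0)"
      by (intro sum.cong) auto
    also have "\<dots> = n * cinner (f (x, a)) (f (y, b))"
      by simp
    finally have sum: "(\<Sum>l<n. \<Sum>m<n. cinner (v' (x, n - 1 - l + a) l) (v' (y, n - 1 - m + b) m)) =
        n * cinner (f (x, a)) (f (y, b))" .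
    have r: "complex_of_real (1 / sqrt n) * (complex_of_real (1 / sqrt n) * n) = 1"
      using assms(4) by (simp add: field_simps flip: of_real_mult)
    have "cinner (g i) (g j) = complex_of_real (1 / sqrt n) * (complex_of_real (1 / sqrt n) *
        (\<Sum>l<n. \<Sum>m<n. cinner (v' (x, n - 1 - l + a) l) (v' (y, n - 1 - m + b) m)))"
      unfolding g_def \<open>i = (x, a)\<close> \<open>j = (y, b)\<close> prod.case cinner_scaleR_left cinner_scaleR_right
        cinner_sum_left
      unfolding cinner_sum_right ..
    also have "\<dots> = cinner (f (x, a)) (f (y, b))"
      unfolding sum using arg_cong[OF r, of "\<lambda>t. t * cinner (f (x, a)) (f (y, b))"]
      by (simp only: mult.assoc mult_1)
    finally show ?thesis by simp
  qed
  then obtain R where R: "R \<in> unitaries" "\<And>i. i \<in> X \<times> {..1} \<Longrightarrow> blinfun_apply R (g i) = f i"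
    using unitary_between_families[of "X \<times> {..1::nat}" g f] assms(3) by auto
  have iso: "R \<in> isometries"
    using R by (simp add: unitaries_eq)
  show thesis
  proof
    define v where "v x k l = blinfun_apply R (v' (x, k) l)" for x k l
    show "cinner (v x j l) (v y k m) =
       (if l = m then cinner (blinfun_apply (power_op T j) x) (blinfun_apply (power_op T k) y) else 0)"
      if "x \<in> X" "y \<in> X" "j \<le> n" "k \<le> n" "l < M" "m < M" for x y j k l m
      using that v'[of "(x, j)" "(y, k)" l m] by (simp add: v_def cinner_isometry[OF iso] z_def)
    show "x = (1 / sqrt n) *\<^sub>R (\<Sum>l<n. v x (n - 1 - l) l)" if "x \<in> X" for x
      using R(2)[of "(x, 0)"] that
      by (simp add: v_def f_def g_def blinfun.scaleR_right blinfun.sum_right)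
    show "blinfun_apply T x = (1 / sqrt n) *\<^sub>R (\<Sum>l<n. v x (n - l) l)" if "x \<in> X" for x
    proof -
      have "(\<Sum>l<n. v x (n - 1 - l + 1) l) = (\<Sum>l<n. v x (n - l) l)"
        by (intro sum.cong) (auto simp: Suc_diff_Suc)
      then show ?thesis
        using R(2)[of "(x, 1)"] that
        by (simp add: v_def f_def g_def blinfun.scaleR_right blinfun.sum_right)
    qed
  qed
qed

lemma unimodular_root:
  assumes "cmod c = 1" "0 < M"
  obtains d where "cmod d = 1" "d ^ M = c"
proof
  show "cmod (cis (Arg c / M)) = 1"
    by simp
  have "cis (Arg c / M) ^ M = cis (Arg c)"
    using assms(2) Complex.DeMoivre[of "Arg c / M" M] by simp
  also have "\<dots> = c"
    using assms(1) by (metis cis_Arg_unique norm_zero sgn_eq zero_neq_one div_by_1 of_real_1 cis_Arg)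
  finally show "cis (Arg c / M) ^ M = c" .
qed

text \<open>The approximating operator is \<open>c\<close> times a cyclic shift of \<open>M\<close> orthogonal levels, where
  \<open>c\<^sup>M = \<kappa>\<close>, so that its \<open>M\<close>-th power is \<open>\<kappa>\<close> on the span of the levels; to compensate for the
  factor, the levels are built for \<open>T' = c\<^sup>-\<^sup>1 T\<close>.
  Each \<open>x \<in> X\<close> is spread evenly over the first \<open>n\<close> levels in such a way that shifting it agrees with
  applying \<open>T'\<close>, except in two boundary levels, where the difference is of size \<open>\<parallel>x\<parallel> / sqrt n\<close>.
  As \<open>x\<close> occupies only \<open>n\<close> of the \<open>M\<close> levels, its first \<open>M - n\<close> iterates do not wrap around. Their
  components form \<open>n\<close> orthogonal families, and Bessel's inequality bounds the sum of the squares by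
  \<open>n \<parallel>x\<parallel>\<^sup>2 \<parallel>y\<parallel>\<^sup>2\<close>, independently of \<open>M\<close>.\<close>

lemma approximation_by_cyclic_shift:
  fixes T :: "'a::complex_hilbert_space \<Rightarrow>\<^sub>L 'a"
  assumes inf: "infinite_dimensional TYPE('a)" and T: "T \<in> isometries" and X: "finite X"
    and eps: "0 < \<epsilon>" and lam: "cmod \<kappa> = 1"
  obtains S where "S \<in> unitaries"
    "\<And>x. x \<in> X \<Longrightarrow> norm (blinfun_apply S x - blinfun_apply T x) < \<epsilon>"
    "\<exists>n\<ge>m. \<forall>x\<in>X. blinfun_apply (power_op S n) x = \<kappa> *\<^sub>C x"
    "\<exists>N\<ge>1. \<forall>x\<in>X. \<forall>y. (\<Sum>n=1..N. (cmod (cinner (blinfun_apply (power_op S n) x) y))\<^sup>2) \<le>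
       \<epsilon> * real N * (norm y)\<^sup>2"
proof -
  obtain b where b: "\<And>x. x \<in> X \<Longrightarrow> norm x \<le> b" "0 < b"
    using finite_imp_bounded[OF X] unfolding bounded_pos by blast
  obtain n :: nat where n: "(2 * b / \<epsilon>)\<^sup>2 < n"
    using reals_Archimedean2 by blast
  then have "0 < n"
    by (metis of_nat_0_less_iff order_le_less_trans zero_le_power2)
  have "2 * b / \<epsilon> < sqrt n"
    using n by (rule real_less_rsqrt)
  then have small: "2 * b / sqrt n < \<epsilon>"
    using eps \<open>0 < n\<close> by (simp add: field_simps)
  obtain N :: nat where "real n * b\<^sup>2 / \<epsilon> < N"
    using reals_Archimedean2 by blast
  define M where "M = n + N + m + 1"
  have N: "n * b\<^sup>2 \<le> \<epsilon> * (M - n)"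
    using \<open>real n * b\<^sup>2 / \<epsilon> < N\<close> eps by (simp add: M_def field_simps) (smt (verit) mult_nonneg_nonneg of_nat_0_le_iff)
  have M: "n < M" "m \<le> M"
    by (auto simp: M_def)
  obtain c where c: "cmod c = 1" "c ^ M = \<kappa>"
    using unimodular_root[OF lam, of M] M by auto
  define T' where "T' = scalar_op (inverse c) o\<^sub>L T"
  have T': "T' \<in> isometries"
    unfolding T'_def using T by (rule scalar_op_compose_isometry) (simp add: norm_inverse c)
  obtain v :: "'a \<Rightarrow> nat \<Rightarrow> nat \<Rightarrow> 'a" where v: "\<And>x y j k l m. x \<in> X \<Longrightarrow> y \<in> X \<Longrightarrow> j \<le> n \<Longrightarrow> k \<le> n \<Longrightarrow> l < M \<Longrightarrow> m < M \<Longrightarrow>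
       cinner (v x j l) (v y k m) =
       (if l = m then cinner (blinfun_apply (power_op T' j) x) (blinfun_apply (power_op T' k) y) else 0)"
    and vx: "\<And>x. x \<in> X \<Longrightarrow> x = (1 / sqrt n) *\<^sub>R (\<Sum>l<n. v x (n - 1 - l) l)"
    and vT: "\<And>x. x \<in> X \<Longrightarrow> blinfun_apply T' x = (1 / sqrt n) *\<^sub>R (\<Sum>l<n. v x (n - l) l)"
    by (rule orthogonal_levels[OF inf T' X \<open>0 < n\<close> M(1)]) (rule that)
  have self: "cinner (v x k l) (v x k l) = cinner x x" if "x \<in> X" "k \<le> n" "l < M" for x k l
    using v[OF that(1,1,2,2,3,3)] cinner_isometry[OF power_op_isometry[OF T']] by simp
  then have nv: "norm (v x k l) = norm x" if "x \<in> X" "k \<le> n" "l < M" for x k l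
    using that norm_eqI by blast
  define p where "p = (\<lambda>(x, k, l). v x k l)"
  define q where "q = (\<lambda>(x, k, l). c *\<^sub>C v x k (Suc l mod M))"
  define I where "I = X \<times> {..n} \<times> {..<M}"
  have cc: "c * cnj c = 1"
    using complex_norm_square[of c] c by simp
  have "cinner (p i) (p j) = cinner (q i) (q j)" if "i \<in> I" "j \<in> I" for i j
  proof -
    obtain x k l y k' l' where [simp]: "i = (x, k, l)" "j = (y, k', l')"
      and *: "x \<in> X" "y \<in> X" "k \<le> n" "k' \<le> n" "l < M" "l' < M"
      using \<open>i \<in> I\<close> \<open>j \<in> I\<close> by (auto simp: I_def)
    have "(Suc l mod M = Suc l' mod M) \<longleftrightarrow> l = l'"
      using * by (auto simp: mod_Suc split: if_splits)
    moreover have "cinner (q i) (q j) = c * cnj c * cinner (v x k (Suc l mod M)) (v y k' (Suc l' mod M))"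
      by (simp add: q_def cinner_scaleC_left cinner_scaleC_right)
    ultimately show ?thesis
      using * M by (simp add: p_def cc v)
  qed
  moreover have "finite I"
    using X by (simp add: I_def)
  ultimately obtain S where S: "S \<in> unitaries" "\<And>i. i \<in> I \<Longrightarrow> blinfun_apply S (p i) = q i"
    using unitary_between_families[of I p q] by blast
  have shift: "blinfun_apply S (v x k l) = c *\<^sub>C v x k (Suc l mod M)" if "x \<in> X" "k \<le> n" "l < M" for x k l
    using S(2)[of "(x, k, l)"] that by (simp add: I_def p_def q_def)
  have bounded: "S \<in> bounded_operators"
    using S(1) by (simp add: unitaries_eq isometries_def)
  have shifts: "blinfun_apply (power_op S j) (v x k l) = c ^ j *\<^sub>C v x k ((l + j) mod M)"
    if "x \<in> X" "k \<le> n" "l < M" for x k l j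
  proof (induction j)
    case (Suc j)
    have "blinfun_apply (power_op S (Suc j)) (v x k l) = c ^ j *\<^sub>C blinfun_apply S (v x k ((l + j) mod M))"
      by (simp add: Suc bounded_operators_scaleC[OF bounded])
    also have "\<dots> = c ^ Suc j *\<^sub>C v x k ((l + Suc j) mod M)"
      using that M by (simp add: shift scaleC_scaleC mod_Suc_eq mult.commute)
    finally show ?case .
  qed (use that in \<open>simp add: scaleC_one\<close>)
  have sum: "blinfun_apply (power_op S j) x = (1 / sqrt n) *\<^sub>R (\<Sum>l<n. c ^ j *\<^sub>C v x (n - 1 - l) ((l + j) mod M))"
    if "x \<in> X" for x j
  proof -
    have "blinfun_apply (power_op S j) x =
        (1 / sqrt n) *\<^sub>R (\<Sum>l<n. blinfun_apply (power_op S j) (v x (n - 1 - l) l))"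
      by (subst vx[OF that]) (simp add: blinfun.scaleR_right blinfun.sum_right)
    also have "(\<Sum>l<n. blinfun_apply (power_op S j) (v x (n - 1 - l) l)) =
        (\<Sum>l<n. c ^ j *\<^sub>C v x (n - 1 - l) ((l + j) mod M))"
      using M that by (intro sum.cong refl shifts) auto
    finally show ?thesis .
  qed
  show thesis
  proof
    show "S \<in> unitaries" by fact
    show "norm (blinfun_apply S x - blinfun_apply T x) < \<epsilon>" if "x \<in> X" for x
    proof -
      have "blinfun_apply S x = blinfun_apply (power_op S 1) x"
        by simp
      also have "\<dots> = (1 / sqrt n) *\<^sub>R (\<Sum>l<n. c *\<^sub>C v x (n - Suc l) (Suc l))"
        unfolding sum[OF that] using M by (intro arg_cong2[of _ _ _ _ scaleR] sum.cong) auto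
      also have "\<dots> = c *\<^sub>C ((1 / sqrt n) *\<^sub>R (\<Sum>l<n. v x (n - Suc l) (Suc l)))"
        by (simp add: scaleC_scaleR scaleC_sum_right)
      finally have 1: "blinfun_apply S x = c *\<^sub>C ((1 / sqrt n) *\<^sub>R (\<Sum>l<n. v x (n - Suc l) (Suc l)))" .
      have "c \<noteq> 0"
        using c by auto
      then have "blinfun_apply T x = c *\<^sub>C blinfun_apply T' x"
        by (simp add: T'_def scalar_op.rep_eq scaleC_scaleC scaleC_one)
      also have "\<dots> = c *\<^sub>C ((1 / sqrt n) *\<^sub>R (\<Sum>l<n. v x (n - l) l))"
        by (simp only: vT[OF that])
      finally have "blinfun_apply S x - blinfun_apply T x =
          c *\<^sub>C ((1 / sqrt n) *\<^sub>R ((\<Sum>l<n. v x (n - Suc l) (Suc l)) - (\<Sum>l<n. v x (n - l) l)))"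
        using 1 by (simp add: scaleC_diff_right scaleR_diff_right)
      also have "(\<Sum>l<n. v x (n - Suc l) (Suc l)) - (\<Sum>l<n. v x (n - l) l) = v x 0 n - v x n 0"
        using sum_lessThan_telescope[of "\<lambda>l. v x (n - l) l" n] by (simp add: sum_subtractf)
      finally have "norm (blinfun_apply S x - blinfun_apply T x) = norm (v x 0 n - v x n 0) / sqrt n"
        by (simp add: norm_scaleC c)
      also have "\<dots> \<le> (norm (v x 0 n) + norm (v x n 0)) / sqrt n"
        by (intro divide_right_mono norm_triangle_ineq4) simp
      also have "\<dots> = 2 * norm x / sqrt n"
        using nv that M by simp
      also have "\<dots> \<le> 2 * b / sqrt n"
        using b(1)[OF that] by (intro divide_right_mono) auto
      finally show ?thesis
        using small by simp
    qed
    have "blinfun_apply (power_op S M) x = \<kappa> *\<^sub>C x" if "x \<in> X" for x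
    proof -
      have "blinfun_apply (power_op S M) x = (1 / sqrt n) *\<^sub>R (\<Sum>l<n. \<kappa> *\<^sub>C v x (n - 1 - l) l)"
        unfolding sum[OF that] c using M by (intro arg_cong2[of _ _ _ _ scaleR] sum.cong) auto
      also have "\<dots> = \<kappa> *\<^sub>C ((1 / sqrt n) *\<^sub>R (\<Sum>l<n. v x (n - 1 - l) l))"
        by (simp add: scaleC_scaleR scaleC_sum_right)
      finally show ?thesis
        using vx[OF that] by simp
    qed
    then show "\<exists>n\<ge>m. \<forall>x\<in>X. blinfun_apply (power_op S n) x = \<kappa> *\<^sub>C x"
      using M by blast
    have "(\<Sum>j=1..M - n. (cmod (cinner (blinfun_apply (power_op S j) x) y))\<^sup>2) \<le> \<epsilon> * real (M - n) * (norm y)\<^sup>2"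
      if "x \<in> X" for x y
    proof -
      have "(cmod (cinner (blinfun_apply (power_op S j) x) y))\<^sup>2 \<le>
          (\<Sum>l<n. (cmod (cinner (v x (n - 1 - l) (l + j)) y))\<^sup>2)" if j: "j \<in> {1..M - n}" for j
      proof -
        have "cinner (blinfun_apply (power_op S j) x) y =
            (1 / sqrt n) * (\<Sum>l<n. c ^ j * cinner (v x (n - 1 - l) ((l + j) mod M)) y)"
          using \<open>x \<in> X\<close> by (simp add: sum cinner_scaleR_left cinner_sum_left cinner_scaleC_left)
        also have "(\<Sum>l<n. c ^ j * cinner (v x (n - 1 - l) ((l + j) mod M)) y) =
            (\<Sum>l<n. c ^ j * cinner (v x (n - 1 - l) (l + j)) y)"
          using j M by (intro sum.cong) auto
        finally have "cmod (cinner (blinfun_apply (power_op S j) x) y) =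
            (1 / sqrt n) * cmod (\<Sum>l<n. c ^ j * cinner (v x (n - 1 - l) (l + j)) y)"
          by (simp add: norm_mult norm_divide)
        also have "\<dots> \<le> (1 / sqrt n) * (\<Sum>l<n. cmod (c ^ j * cinner (v x (n - 1 - l) (l + j)) y))"
          by (intro mult_left_mono norm_sum) auto
        also have "\<dots> = (1 / sqrt n) * (\<Sum>l<n. cmod (cinner (v x (n - 1 - l) (l + j)) y))"
          by (simp add: norm_mult norm_power c)
        finally have "(cmod (cinner (blinfun_apply (power_op S j) x) y))\<^sup>2 \<le>
            ((1 / sqrt n) * (\<Sum>l<n. cmod (cinner (v x (n - 1 - l) (l + j)) y)))\<^sup>2"
          by (intro power_mono) auto
        also have "\<dots> = (1 / n) * (\<Sum>l<n. cmod (cinner (v x (n - 1 - l) (l + j)) y))\<^sup>2"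
          by (simp add: power_divide)
        also have "\<dots> \<le> (1 / n) * (n * (\<Sum>l<n. (cmod (cinner (v x (n - 1 - l) (l + j)) y))\<^sup>2))"
          using sum_squared_le_sum_of_squares[of "\<lambda>l. cmod (cinner (v x (n - 1 - l) (l + j)) y)" "{..<n}"] \<open>0 < n\<close>
          by (intro mult_left_mono) (auto simp: mult.commute)
        finally show ?thesis
          using \<open>0 < n\<close> by simp
      qed
      then have "(\<Sum>j=1..M - n. (cmod (cinner (blinfun_apply (power_op S j) x) y))\<^sup>2) \<le>
          (\<Sum>j=1..M - n. \<Sum>l<n. (cmod (cinner (v x (n - 1 - l) (l + j)) y))\<^sup>2)"
        by (rule sum_mono)
      also have "\<dots> = (\<Sum>l<n. \<Sum>j=1..M - n. (cmod (cinner (v x (n - 1 - l) (l + j)) y))\<^sup>2)"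
        by (rule sum.swap)
      also have "\<dots> \<le> (\<Sum>l<n. b\<^sup>2 * (norm y)\<^sup>2)"
      proof (rule sum_mono)
        fix l assume "l \<in> {..<n}"
        then have "(\<Sum>j=1..M - n. (cmod (cinner (v x (n - 1 - l) (l + j)) y))\<^sup>2) \<le> (norm x)\<^sup>2 * (norm y)\<^sup>2"
          using that M v self
          by (intro Bessel_inequality) (auto simp: cinner_self[of x])
        also have "\<dots> \<le> b\<^sup>2 * (norm y)\<^sup>2"
          using b(1)[OF that] by (intro mult_right_mono power_mono) auto
        finally show "(\<Sum>j=1..M - n. (cmod (cinner (v x (n - 1 - l) (l + j)) y))\<^sup>2) \<le> b\<^sup>2 * (norm y)\<^sup>2" .
      qed
      also have "\<dots> = n * b\<^sup>2 * (norm y)\<^sup>2"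
        by simp
      also have "\<dots> \<le> \<epsilon> * real (M - n) * (norm y)\<^sup>2"
        using N M by (intro mult_right_mono) (auto simp: of_nat_diff)
      finally show ?thesis .
    qed
    then show "\<exists>N\<ge>1. \<forall>x\<in>X. \<forall>y. (\<Sum>n=1..N. (cmod (cinner (blinfun_apply (power_op S n) x) y))\<^sup>2) \<le>
       \<epsilon> * real N * (norm y)\<^sup>2"
      using M by (intro exI[of _ "M - n"]) auto
  qed
qed

text \<open>Contractions are approximated in the weak sense: the defect form
  \<open>\<langle>x, y\<rangle> - \<langle>T x, T y\<rangle>\<close> is positive, and adding to each \<open>T x\<close> a vector that is invisible to the
  test vectors and carries the defect gives a family with the Gram matrix of the original one.\<close>

lemma unitary_agreeing_weakly_with_contraction:
  fixes T :: "'a::complex_hilbert_space \<Rightarrow>\<^sub>L 'a"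
  assumes inf: "infinite_dimensional TYPE('a)" and T: "T \<in> contractions" and "finite X" "finite Y"
  shows "\<exists>R\<in>unitaries. \<forall>x\<in>X. \<forall>y\<in>Y. cinner (blinfun_apply R x) y = cinner (blinfun_apply T x) y"
proof -
  have bounded: "T \<in> bounded_operators" and norm: "norm T \<le> 1"
    using T by (auto simp: contractions_def)
  define B where "B x y = cinner x y - cinner (blinfun_apply T x) (blinfun_apply T y)" for x y
  have "norm (blinfun_apply T x) \<le> norm x" for x
    using norm_power_op_le[OF norm, of 1] by simp
  then have "psd_form B"
    unfolding psd_form_def B_def
    by (auto simp: cinner_add_left cinner_scaleC_left blinfun.add_right bounded_operators_scaleC[OF bounded]
        algebra_simps cinner_self power_mono intro: cinner_commute)
      (metis cinner_commute)
  moreover have "finite (Y \<union> blinfun_apply T ` X)"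
    using assms by simp
  ultimately obtain v where v: "\<And>x a. x \<in> X \<Longrightarrow> a \<in> Y \<union> blinfun_apply T ` X \<Longrightarrow> cinner (v x) a = 0"
    "\<And>x y. x \<in> X \<Longrightarrow> y \<in> X \<Longrightarrow> cinner (v x) (v y) = B x y"
    using Gram_realization[OF inf \<open>finite X\<close>, of "Y \<union> blinfun_apply T ` X" B "\<lambda>x. x"] by metis
  have "cinner x y = cinner (blinfun_apply T x + v x) (blinfun_apply T y + v y)"
    if "x \<in> X" "y \<in> X" for x y
    using v(1)[OF that(1), of "blinfun_apply T y"] v(1)[OF that(2), of "blinfun_apply T x"] that
      cinner_commute[of "blinfun_apply T x" "v y"]
    by (simp add: cinner_add_left cinner_add_right v(2) B_def)
  then obtain R where "R \<in> unitaries" "\<forall>x\<in>X. blinfun_apply R x = blinfun_apply T x + v x"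
    using unitary_between_families[OF \<open>finite X\<close>, of "\<lambda>x. x" "\<lambda>x. blinfun_apply T x + v x"] by auto
  then show ?thesis
    using v(1) by (intro bexI[of _ R]) (auto simp: cinner_add_left)
qed

section \<open>Residual sets in the three operator topologies\<close>

lemma residual_inI:
  assumes "A \<subseteq> topspace X" "countable \<O>" "\<And>U. U \<in> \<O> \<Longrightarrow> openin X U"
    and dense: "\<And>U V. U \<in> \<O> \<Longrightarrow> openin X V \<Longrightarrow> V \<noteq> {} \<Longrightarrow> U \<inter> V \<noteq> {}"
    and "topspace X \<inter> \<Inter>\<O> \<subseteq> A"
  shows "residual_in X A"
  unfolding residual_in_def first_category_in_def
proof (intro conjI exI)
  let ?N = "(\<lambda>U. topspace X - A - U) ` \<O>"
  show "countable ?N"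
    using assms by simp
  show "\<forall>N\<in>?N. nowhere_dense_in X N"
  proof
    fix N assume "N \<in> ?N"
    then obtain U where U: "U \<in> \<O>" "N = topspace X - A - U" by auto
    have "X closure_of N \<subseteq> topspace X - U"
      using U assms(3) by (intro closure_of_minimal) auto
    moreover have "X interior_of (X closure_of N) \<subseteq> X closure_of N"
      by (rule interior_of_subset)
    ultimately have "X interior_of (X closure_of N) = {}"
      using dense[OF U(1) openin_interior_of] by blast
    then show "nowhere_dense_in X N"
      using U by (auto simp: nowhere_dense_in_def)
  qed
  show "topspace X - A = \<Union>?N"
    using assms(5) by auto
qed (fact assms)

lemma seminorm_topology_topspace:
  assumes "P \<noteq> {}" "\<And>p. p \<in> P \<Longrightarrow> p 0 = 0"
  shows "topspace (seminorm_topology V P) = V"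
proof -
  obtain p where "p \<in> P" using assms(1) by blast
  then have "T \<in> {S \<in> V. p (S - T) < 1}" if "T \<in> V" for T
    using that assms(2)[OF \<open>p \<in> P\<close>] by simp
  then have "V \<subseteq> \<Union>{{S \<in> V. p (S - T) < e} | p T e. p \<in> P \<and> T \<in> V \<and> 0 < e}"
    using \<open>p \<in> P\<close> zero_less_one by blast
  then show ?thesis
    unfolding seminorm_topology_def topology_generated_by_topspace by auto
qed

lemma seminorm_topology_nbhd:
  assumes "openin (seminorm_topology V P) W" "T \<in> W"
    and tri: "\<And>p R S T. p \<in> P \<Longrightarrow> R \<in> V \<Longrightarrow> S \<in> V \<Longrightarrow> T \<in> V \<Longrightarrow> p (R - T) \<le> p (R - S) + p (S - T)"
  shows "\<exists>Q\<subseteq>P. \<exists>e>0. finite Q \<and> {S \<in> V. \<forall>p\<in>Q. p (S - T) < e} \<subseteq> W"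
proof -
  have "generate_topology_on {{S \<in> V. p (S - T) < e} | p T e. p \<in> P \<and> T \<in> V \<and> 0 < e} W"
    using assms(1) unfolding seminorm_topology_def by (rule openin_topology_generated_by)
  then show ?thesis
    using assms(2)
  proof (induction arbitrary: T)
    case (Int A B)
    obtain Q e where "Q \<subseteq> P" "0 < e" "finite Q" "{S \<in> V. \<forall>p\<in>Q. p (S - T) < e} \<subseteq> A"
      using Int.IH(1)[of T] Int.prems by blast
    moreover obtain Q' e' where "Q' \<subseteq> P" "0 < e'" "finite Q'" "{S \<in> V. \<forall>p\<in>Q'. p (S - T) < e'} \<subseteq> B"
      using Int.IH(2)[of T] Int.prems by blast
    ultimately show ?case
      by (intro exI[of _ "Q \<union> Q'"] conjI exI[of _ "min e e'"]) auto
  next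
    case (UN K)
    then obtain A where "A \<in> K" "T \<in> A" by blast
    with UN.IH[of A T] show ?case
      by (meson Union_upper order_trans)
  next
    case (Basis B)
    then obtain p R e where B: "B = {S \<in> V. p (S - R) < e}" "p \<in> P" "R \<in> V" "0 < e" by blast
    have "S \<in> B" if "S \<in> V" "p (S - T) < e - p (T - R)" for S
      using tri[of p S T R] that Basis.prems B by auto
    then show ?case
      using B Basis.prems by (intro exI[of _ "{p}"] conjI exI[of _ "e - p (T - R)"]) auto
  qed simp
qed

lemma openin_seminorm_subtopologyI:
  assumes "P \<noteq> {}" "\<And>p. p \<in> P \<Longrightarrow> p 0 = 0" "W \<subseteq> D" "D \<subseteq> V"
    and "\<And>T. T \<in> W \<Longrightarrow> \<exists>Q\<subseteq>P. \<exists>e>0. finite Q \<and> {S \<in> D. \<forall>p\<in>Q. p (S - T) < e} \<subseteq> W"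
  shows "openin (subtopology (seminorm_topology V P) D) W"
proof (subst openin_subopen, intro ballI)
  fix T assume T: "T \<in> W"
  obtain Q e where Q: "Q \<subseteq> P" "0 < e" "finite Q" "{S \<in> D. \<forall>p\<in>Q. p (S - T) < e} \<subseteq> W"
    using assms(5)[OF T] by blast
  let ?B = "(\<Inter>p\<in>Q. {S \<in> V. p (S - T) < e}) \<inter> topspace (seminorm_topology V P)"
  have "openin (seminorm_topology V P) {S \<in> V. p (S - T) < e}" if "p \<in> Q" for p
    unfolding seminorm_topology_def
    using that Q T assms(3,4) by (intro topology_generated_by_Basis) blast
  then have "openin (seminorm_topology V P) ?B"
    using Q(3) by (intro openin_INT)
  then have "openin (subtopology (seminorm_topology V P) D) (?B \<inter> D)"
    by (auto simp: openin_subtopology)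
  have "topspace (seminorm_topology V P) = V"
    using assms(1,2) by (rule seminorm_topology_topspace)
  moreover have "p (T - T) < e" if "p \<in> Q" for p
    using assms(2)[of p] that Q(1,2) by auto
  ultimately have "T \<in> ?B \<inter> D"
    using T assms(3,4) by auto
  moreover have "?B \<inter> D \<subseteq> W"
    using Q(4) by auto
  moreover note \<open>openin (subtopology (seminorm_topology V P) D) (?B \<inter> D)\<close>
  ultimately show "\<exists>U. openin (subtopology (seminorm_topology V P) D) U \<and> T \<in> U \<and> U \<subseteq> W"
    by blast
qed

lemma weak_operator_topology_topspace: "topspace weak_operator_topology = bounded_operators"
  unfolding weak_operator_topology_def by (rule seminorm_topology_topspace) auto

lemma weak_operator_topology_nbhd:
  fixes T :: "'a::complex_inner \<Rightarrow>\<^sub>L 'a"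
  assumes "openin weak_operator_topology W" "T \<in> W"
  obtains X Y e where "finite X" "finite Y" "0 < e"
    "\<forall>S\<in>bounded_operators.
      (\<forall>x\<in>X. \<forall>y\<in>Y. cmod (cinner (blinfun_apply (S - T) x) y) < e) \<longrightarrow> S \<in> W"
proof -
  let ?p = "\<lambda>(x, y) (T :: 'a \<Rightarrow>\<^sub>L 'a). cmod (cinner (blinfun_apply T x) y)"
  have eq: "{\<lambda>T. cmod (cinner (blinfun_apply T x) y) | x y. True} = range ?p"
    by auto
  have "\<exists>Q\<subseteq>range ?p. \<exists>e>0. finite Q \<and> {S \<in> bounded_operators. \<forall>p\<in>Q. p (S - T) < e} \<subseteq> W"
  proof (rule seminorm_topology_nbhd)
    show "openin (seminorm_topology bounded_operators (range ?p)) W"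
      using assms(1) unfolding weak_operator_topology_def eq .
    show "T \<in> W" by fact
    show "p (R - T) \<le> p (R - S) + p (S - T)" if p: "p \<in> range ?p" for p R S T
    proof -
      obtain x y where p: "p = (\<lambda>T. cmod (cinner (blinfun_apply T x) y))"
        using p by auto
      have "cinner (blinfun_apply (R - T) x) y =
          cinner (blinfun_apply (R - S) x) y + cinner (blinfun_apply (S - T) x) y"
        by (simp add: blinfun.diff_left cinner_diff_left)
      then show ?thesis
        unfolding p by (metis norm_triangle_ineq)
    qed
  qed
  then obtain Q e where Q: "Q \<subseteq> range ?p" "0 < e" "finite Q"
    "{S \<in> bounded_operators. \<forall>p\<in>Q. p (S - T) < e} \<subseteq> W"
    by blast
  then obtain Z where Z: "finite Z" "Q = ?p ` Z"
    using finite_subset_image[OF Q(3,1)] by blast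
  show thesis
  proof (rule that[of "fst ` Z" "snd ` Z"])
    show "\<forall>S\<in>bounded_operators. (\<forall>x\<in>fst ` Z. \<forall>y\<in>snd ` Z.
        cmod (cinner (blinfun_apply (S - T) x) y) < e) \<longrightarrow> S \<in> W"
    proof (intro ballI impI)
      fix S :: "'a \<Rightarrow>\<^sub>L 'a" assume S: "S \<in> bounded_operators"
        "\<forall>x\<in>fst ` Z. \<forall>y\<in>snd ` Z. cmod (cinner (blinfun_apply (S - T) x) y) < e"
      have "\<forall>p\<in>?p ` Z. p (S - T) < e"
        using S(2) by force
      then show "S \<in> W"
        using Q(4) S(1) unfolding Z(2) by blast
    qed
  qed (use Z Q in auto)
qed

lemma openin_weak_operator_subtopologyI:
  assumes "W \<subseteq> D" "D \<subseteq> bounded_operators"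
    and "\<And>T. T \<in> W \<Longrightarrow> \<exists>Z e. finite Z \<and> 0 < e \<and>
      {S \<in> D. \<forall>(x,y)\<in>Z. cmod (cinner (blinfun_apply (S - T) x) y) < e} \<subseteq> W"
  shows "openin (subtopology weak_operator_topology D) W"
  unfolding weak_operator_topology_def
proof (rule openin_seminorm_subtopologyI)
  fix T assume "T \<in> W"
  then obtain Z e where Z: "finite Z" "0 < e"
    "{S \<in> D. \<forall>(x,y)\<in>Z. cmod (cinner (blinfun_apply (S - T) x) y) < e} \<subseteq> W"
    using assms(3) by blast
  let ?Q = "(\<lambda>(x, y) T. cmod (cinner (blinfun_apply T x) y)) ` Z"
  have "?Q \<subseteq> {\<lambda>T. cmod (cinner (blinfun_apply T x) y) | x y. True}" "finite ?Q"
    "{S \<in> D. \<forall>p\<in>?Q. p (S - T) < e} \<subseteq> W"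
    using Z by auto
  then show "\<exists>Q\<subseteq>{\<lambda>T. cmod (cinner (blinfun_apply T x) y) | x y. True}. \<exists>e>0. finite Q \<and>
      {S \<in> D. \<forall>p\<in>Q. p (S - T) < e} \<subseteq> W"
    using Z(2) by blast
qed (use assms in auto)

text \<open>In this form the triangle inequality is that of the product space.\<close>

lemma strong_star_seminorm_eq:
  "sqrt ((norm (blinfun_apply T x))\<^sup>2 + (norm (blinfun_apply (adjoint_op T) x))\<^sup>2) =
    norm (blinfun_apply T x, blinfun_apply (adjoint_op T) x)"
  by (simp add: norm_Pair)

lemma adjoint_op_zero: "adjoint_op 0 = 0"
  by (rule adjoint_op_eqI) simp

lemma strong_star_operator_topology_topspace:
  "topspace strong_star_operator_topology = bounded_operators"
  unfolding strong_star_operator_topology_def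
  by (rule seminorm_topology_topspace) (auto simp: adjoint_op_zero)

lemma strong_star_operator_topology_nbhd:
  fixes T :: "'a::complex_hilbert_space \<Rightarrow>\<^sub>L 'a"
  assumes "openin strong_star_operator_topology W" "T \<in> W"
  obtains X e where "finite X" "0 < e"
    "\<forall>S\<in>bounded_operators. (\<forall>x\<in>X.
      norm (blinfun_apply (S - T) x, blinfun_apply (adjoint_op (S - T)) x) < e) \<longrightarrow> S \<in> W"
proof -
  let ?p = "\<lambda>(x :: 'a) (T :: 'a \<Rightarrow>\<^sub>L 'a). norm (blinfun_apply T x, blinfun_apply (adjoint_op T) x)"
  have eq: "{\<lambda>T. sqrt ((norm (blinfun_apply T x))\<^sup>2 +
      (norm (blinfun_apply (adjoint_op T) (x :: 'a)))\<^sup>2) | x. True} = range ?p"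
    unfolding strong_star_seminorm_eq by auto
  have "\<exists>Q\<subseteq>range ?p. \<exists>e>0. finite Q \<and> {S \<in> bounded_operators. \<forall>p\<in>Q. p (S - T) < e} \<subseteq> W"
  proof (rule seminorm_topology_nbhd)
    show "openin (seminorm_topology bounded_operators (range ?p)) W"
      using assms(1) unfolding strong_star_operator_topology_def eq .
    show "T \<in> W" by fact
    show "p (R - T) \<le> p (R - S) + p (S - T)"
      if p: "p \<in> range ?p" and "R \<in> bounded_operators" "S \<in> bounded_operators" "T \<in> bounded_operators" for p R S T
    proof -
      obtain x where p: "p = ?p x"
        using p by auto
      have "(blinfun_apply (R - T) x, blinfun_apply (adjoint_op (R - T)) x) =
          (blinfun_apply (R - S) x, blinfun_apply (adjoint_op (R - S)) x) +
          (blinfun_apply (S - T) x, blinfun_apply (adjoint_op (S - T)) x)"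
        using that by (simp add: blinfun.diff_left adjoint_op_diff)
      then show ?thesis
        unfolding p by (metis norm_triangle_ineq)
    qed
  qed
  then obtain Q e where Q: "Q \<subseteq> range ?p" "0 < e" "finite Q"
    "{S \<in> bounded_operators. \<forall>p\<in>Q. p (S - T) < e} \<subseteq> W"
    by blast
  then obtain Z where Z: "finite Z" "Q = ?p ` Z"
    using finite_subset_image[OF Q(3,1)] by blast
  show thesis
  proof (rule that[of Z])
    show "\<forall>S\<in>bounded_operators. (\<forall>x\<in>Z. ?p x (S - T) < e) \<longrightarrow> S \<in> W"
      using Q(4) unfolding Z(2) by (auto simp: subset_iff)
  qed (use Z Q in auto)
qed

lemma strong_operator_topology_nbhd:
  fixes T :: "'a::real_normed_vector \<Rightarrow>\<^sub>L 'b::real_normed_vector"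
  assumes "openin strong_operator_topology W" "T \<in> W"
  obtains X e where "finite X" "0 < e"
    "\<forall>S. (\<forall>x\<in>X. norm (blinfun_apply S x - blinfun_apply T x) < e) \<longrightarrow> S \<in> W"
proof -
  obtain U where U: "open U" "W = blinfun_apply -` U"
    using assms(1) unfolding strong_operator_topology_def
    by (auto simp: openin_pullback_topology)
  then have "openin (product_topology (\<lambda>i. euclidean) UNIV) U" "blinfun_apply T \<in> U"
    using assms(2) by (auto simp: euclidean_product_topology)
  then obtain B where B: "blinfun_apply T \<in> (\<Pi>\<^sub>E i\<in>UNIV. B i)" "\<And>i. open (B i)"
    "finite {i. B i \<noteq> UNIV}" "(\<Pi>\<^sub>E i\<in>UNIV. B i) \<subseteq> U"
    using product_topology_open_contains_basis[of "\<lambda>i. euclidean" UNIV U "blinfun_apply T"] by auto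
  let ?X = "{i. B i \<noteq> UNIV}"
  have "\<forall>i. \<exists>e>0. ball (blinfun_apply T i) e \<subseteq> B i"
    using B(1,2) by (auto simp: PiE_iff open_contains_ball)
  then obtain r where r: "\<And>i. 0 < r i" "\<And>i. ball (blinfun_apply T i) (r i) \<subseteq> B i"
    by metis
  define e where "e = Min (insert 1 (r ` ?X))"
  show thesis
  proof
    show "finite ?X" by fact
    show "0 < e"
      using B(3) r by (simp add: e_def)
    show "\<forall>S. (\<forall>x\<in>?X. norm (blinfun_apply S x - blinfun_apply T x) < e) \<longrightarrow> S \<in> W"
    proof (intro allI impI)
      fix S assume S: "\<forall>x\<in>?X. norm (blinfun_apply S x - blinfun_apply T x) < e"
      have "blinfun_apply S i \<in> B i" for i
      proof (cases "i \<in> ?X")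
        case True
        have "e \<le> r i"
          unfolding e_def using B(3) True by (intro Min_le) auto
        then show ?thesis
          using r(2)[of i] S[rule_format, OF True] by (auto simp: dist_norm norm_minus_commute subset_iff)
      qed auto
      then show "S \<in> W"
        using B(4) U by auto
    qed
  qed
qed

text \<open>Relative openness in the set of isometries for the strong operator topology, and density of
  the unitary elements of \<open>W\<close> in it, expressed through the basic neighbourhoods. On isometries the
  weak and the strong operator topology coincide, and on unitaries all three topologies do, so that
  both notions can be transferred to all three spaces.\<close>

definition strongly_open_in_isometries :: "('a::complex_inner \<Rightarrow>\<^sub>L 'a) set \<Rightarrow> bool" where
  "strongly_open_in_isometries W \<longleftrightarrow> W \<subseteq> isometries \<and>
     (\<forall>T\<in>W. \<exists>X e. finite X \<and> 0 < e \<and>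
       (\<forall>S\<in>isometries. (\<forall>x\<in>X. norm (blinfun_apply S x - blinfun_apply T x) < e) \<longrightarrow> S \<in> W))"

definition unitarily_dense_in_isometries :: "('a::complex_inner \<Rightarrow>\<^sub>L 'a) set \<Rightarrow> bool" where
  "unitarily_dense_in_isometries W \<longleftrightarrow>
     (\<forall>T\<in>isometries. \<forall>X e. finite X \<longrightarrow> 0 < e \<longrightarrow>
       (\<exists>S\<in>W \<inter> unitaries. \<forall>x\<in>X. norm (blinfun_apply S x - blinfun_apply T x) < e))"

lemma openin_strong_isometries:
  assumes "strongly_open_in_isometries W"
  shows "openin (subtopology strong_operator_topology isometries) W"
proof (subst openin_subopen, intro ballI)
  fix T assume T: "T \<in> W"
  obtain X e where X: "finite X" "0 < e"
    "\<And>S. S \<in> isometries \<Longrightarrow> \<forall>x\<in>X. norm (blinfun_apply S x - blinfun_apply T x) < e \<Longrightarrow> S \<in> W"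
    using assms T unfolding strongly_open_in_isometries_def by meson
  let ?B = "{S. \<forall>x\<in>X. blinfun_apply S x \<in> ball (blinfun_apply T x) e}"
  have "openin strong_operator_topology ?B"
    using strong_operator_topology_basis[OF X(1), of "\<lambda>x. ball (blinfun_apply T x) e" "\<lambda>x. x"] by simp
  then have "openin (subtopology strong_operator_topology isometries) (?B \<inter> isometries)"
    by (auto simp: openin_subtopology)
  moreover have "T \<in> ?B \<inter> isometries"
    using assms T X(2) by (auto simp: strongly_open_in_isometries_def)
  moreover have "?B \<inter> isometries \<subseteq> W"
    using X(3) by (auto simp: dist_norm norm_minus_commute)
  ultimately show "\<exists>U. openin (subtopology strong_operator_topology isometries) U \<and> T \<in> U \<and> U \<subseteq> W"
    by blast
qed

lemma unitaries_subset_isometries: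
  "unitaries \<subseteq> (isometries :: ('a::complex_hilbert_space \<Rightarrow>\<^sub>L 'a) set)"
  by (auto simp: unitaries_eq)

lemma openin_strong_star_unitaries:
  fixes W :: "('a::complex_hilbert_space \<Rightarrow>\<^sub>L 'a) set"
  assumes "strongly_open_in_isometries W"
  shows "openin (subtopology strong_star_operator_topology unitaries) (W \<inter> unitaries)"
  unfolding strong_star_operator_topology_def
proof (rule openin_seminorm_subtopologyI)
  fix T :: "'a \<Rightarrow>\<^sub>L 'a" assume T: "T \<in> W \<inter> unitaries"
  obtain X e where X: "finite X" "0 < e"
    "\<And>S. S \<in> isometries \<Longrightarrow> \<forall>x\<in>X. norm (blinfun_apply S x - blinfun_apply T x) < e \<Longrightarrow> S \<in> W"
    using assms T unfolding strongly_open_in_isometries_def by (meson IntD1)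
  let ?p = "\<lambda>(x :: 'a) (T :: 'a \<Rightarrow>\<^sub>L 'a). sqrt ((norm (blinfun_apply T x))\<^sup>2 + (norm (blinfun_apply (adjoint_op T) x))\<^sup>2)"
  have le: "norm (blinfun_apply S x) \<le> ?p x S" for x and S :: "'a \<Rightarrow>\<^sub>L 'a"
    by (rule real_le_rsqrt) simp
  have "{S \<in> unitaries. \<forall>p\<in>?p ` X. p (S - T) < e} \<subseteq> W \<inter> unitaries"
  proof
    fix S assume "S \<in> {S \<in> unitaries. \<forall>p\<in>?p ` X. p (S - T) < e}"
    then have S: "S \<in> unitaries" "\<forall>p\<in>?p ` X. p (S - T) < e" by auto
    have "norm (blinfun_apply S x - blinfun_apply T x) < e" if "x \<in> X" for x
      using order_le_less_trans[OF le[of "S - T" x]] S(2) that by (simp add: blinfun.diff_left)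
    then show "S \<in> W \<inter> unitaries"
      using X(3) S(1) unitaries_subset_isometries by blast
  qed
  then show "\<exists>Q\<subseteq>{?p x | x. True}. \<exists>e>0. finite Q \<and> {S \<in> unitaries. \<forall>p\<in>Q. p (S - T) < e} \<subseteq> W \<inter> unitaries"
    using X(1,2) by (intro exI[of _ "?p ` X"] conjI exI[of _ e]) auto
qed (auto simp: adjoint_op_zero unitaries_def)

text \<open>For isometries \<open>S, T\<close> the weak convergence of \<open>S\<close> to \<open>T\<close> implies the strong one, as
  \<open>\<parallel>S x - T x\<parallel>\<^sup>2 = - 2 Re \<langle>(S - T) x, T x\<rangle>\<close>.\<close>

lemma openin_weak_isometries:
  assumes "strongly_open_in_isometries W"
  shows "openin (subtopology weak_operator_topology isometries) W"
proof (rule openin_weak_operator_subtopologyI)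
  fix T assume T: "T \<in> W"
  then have iso: "T \<in> isometries"
    using assms by (auto simp: strongly_open_in_isometries_def)
  obtain X e where X: "finite X" "0 < e"
    "\<And>S. S \<in> isometries \<Longrightarrow> \<forall>x\<in>X. norm (blinfun_apply S x - blinfun_apply T x) < e \<Longrightarrow> S \<in> W"
    using assms T unfolding strongly_open_in_isometries_def by meson
  let ?Z = "(\<lambda>x. (x, blinfun_apply T x)) ` X"
  have "{S \<in> isometries. \<forall>(x,y)\<in>?Z. cmod (cinner (blinfun_apply (S - T) x) y) < e\<^sup>2 / 2} \<subseteq> W"
  proof clarify
    fix S assume S: "S \<in> isometries"
      "\<forall>(x,y)\<in>?Z. cmod (cinner (blinfun_apply (S - T) x) y) < e\<^sup>2 / 2"
    show "S \<in> W"
    proof (rule X(3)[OF S(1)], intro ballI)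
      fix x assume "x \<in> X"
      let ?d = "blinfun_apply S x - blinfun_apply T x"
      have "(norm ?d)\<^sup>2 = - 2 * inner ?d (blinfun_apply T x)"
        using isometriesD(2)[OF S(1), of x] isometriesD(2)[OF iso, of x]
        by (simp add: power2_norm_eq_inner inner_simps inner_commute norm_eq)
      also have "\<dots> \<le> 2 * cmod (cinner ?d (blinfun_apply T x))"
        using abs_Re_le_cmod[of "cinner ?d (blinfun_apply T x)"] by (simp add: inner_eq_Re_cinner)
      also have "\<dots> < e\<^sup>2"
        using S(2) \<open>x \<in> X\<close> by (force simp: blinfun.diff_left)
      finally show "norm ?d < e"
        using X(2) by (auto intro: power2_less_imp_less)
    qed
  qed
  then show "\<exists>Z e. finite Z \<and> 0 < e \<and>
      {S \<in> isometries. \<forall>(x,y)\<in>Z. cmod (cinner (blinfun_apply (S - T) x) y) < e} \<subseteq> W"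
    using X(1,2) by (intro exI[of _ ?Z] exI[of _ "e\<^sup>2 / 2"]) auto
qed (use assms in \<open>auto simp: strongly_open_in_isometries_def isometries_def\<close>)

text \<open>The function \<open>T \<mapsto> \<parallel>T x\<parallel>\<close> is lower semicontinuous for the weak operator topology, being a
  supremum of the functions \<open>T \<mapsto> \<bar>\<langle>T x, y\<rangle>\<bar>\<close> over unit vectors \<open>y\<close>; this makes the isometries a \<open>G\<^sub>\<delta>\<close> set of contractions.\<close>

lemma openin_weak_norm_greater:
  "openin (subtopology weak_operator_topology contractions)
     {T \<in> contractions. r < norm (blinfun_apply T x)}"
proof (rule openin_weak_operator_subtopologyI)
  fix T assume "T \<in> {T \<in> contractions. r < norm (blinfun_apply T x)}"
  then have T: "T \<in> contractions" "r < norm (blinfun_apply T x)"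
    by auto
  let ?y = "blinfun_apply T x"
  show "\<exists>Z e. finite Z \<and> 0 < e \<and>
      {S \<in> contractions. \<forall>(x,y)\<in>Z. cmod (cinner (blinfun_apply (S - T) x) y) < e} \<subseteq>
      {T \<in> contractions. r < norm (blinfun_apply T x)}"
  proof (cases "?y = 0")
    case True
    then have "r < 0"
      using T by simp
    then have "{T \<in> contractions. r < norm (blinfun_apply T x)} = contractions"
      by (auto intro: less_le_trans)
    then show ?thesis
      by (intro exI[of _ "{}"] exI[of _ 1]) auto
  next
    case False
    let ?e = "norm ?y * (norm ?y - r)"
    have "r < norm (blinfun_apply S x)" if "cmod (cinner (blinfun_apply (S - T) x) ?y) < ?e" for S
    proof -
      have "cinner ?y ?y = cinner (blinfun_apply S x) ?y - cinner (blinfun_apply (S - T) x) ?y"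
        by (simp add: blinfun.diff_left cinner_diff_left)
      then have "cmod (cinner ?y ?y) \<le>
          cmod (cinner (blinfun_apply S x) ?y) + cmod (cinner (blinfun_apply (S - T) x) ?y)"
        by (metis norm_triangle_ineq4)
      moreover have "cmod (cinner ?y ?y) = norm ?y * norm ?y"
        by (simp add: cinner_self norm_power flip: power2_eq_square)
      moreover have "cmod (cinner (blinfun_apply S x) ?y) \<le> norm (blinfun_apply S x) * norm ?y"
        by (rule cmod_cinner_le)
      ultimately have "norm ?y * r < norm ?y * norm (blinfun_apply S x)"
        using that by (simp add: algebra_simps)
      then show ?thesis
        using False by simp
    qed
    then show ?thesis
      using False T by (intro exI[of _ "{(x, ?y)}"] exI[of _ ?e]) auto
  qed
qed (auto simp: contractions_def)

lemma bounded_operators_isometries: "isometries \<subseteq> bounded_operators"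
  by (auto simp: isometries_def)

text \<open>Weak approximation of contractions by unitaries followed by strong approximation of
  the latter.\<close>

lemma unitarily_dense_weak:
  fixes W :: "('a::complex_hilbert_space \<Rightarrow>\<^sub>L 'a) set"
  assumes inf: "infinite_dimensional TYPE('a)" and "unitarily_dense_in_isometries W"
    and V: "openin (subtopology weak_operator_topology contractions) V" "V \<noteq> {}"
  shows "W \<inter> unitaries \<inter> V \<noteq> {}"
proof -
  obtain V' where V': "openin weak_operator_topology V'" "V = V' \<inter> contractions"
    using V(1) by (auto simp: openin_subtopology)
  obtain T where T: "T \<in> V'" "T \<in> contractions"
    using V(2) V' by blast
  obtain X Y e where XY: "finite X" "finite Y" "0 < e" "\<forall>S\<in>bounded_operators.
      (\<forall>x\<in>X. \<forall>y\<in>Y. cmod (cinner (blinfun_apply (S - T) x) y) < e) \<longrightarrow> S \<in> V'"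
    by (rule weak_operator_topology_nbhd[OF V'(1) T(1)]) (rule that)
  obtain R where R: "R \<in> unitaries"
    "\<And>x y. x \<in> X \<Longrightarrow> y \<in> Y \<Longrightarrow> cinner (blinfun_apply R x) y = cinner (blinfun_apply T x) y"
    using unitary_agreeing_weakly_with_contraction[OF inf T(2) XY(1,2)] by blast
  obtain b where b: "0 < b" "\<And>y. y \<in> Y \<Longrightarrow> norm y \<le> b"
    using finite_imp_bounded[OF XY(2)] unfolding bounded_pos by blast
  have "R \<in> isometries"
    using R(1) unitaries_subset_isometries by blast
  moreover have "0 < e / b"
    using XY(3) b(1) by simp
  ultimately obtain S where S: "S \<in> W" "S \<in> unitaries"
    "\<And>x. x \<in> X \<Longrightarrow> norm (blinfun_apply S x - blinfun_apply R x) < e / b"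
    using assms(2) XY(1) unfolding unitarily_dense_in_isometries_def by (metis IntD1 IntD2)
  have iso: "S \<in> isometries"
    using S(2) unitaries_subset_isometries by blast
  have "S \<in> V'"
  proof (rule XY(4)[rule_format])
    show "S \<in> bounded_operators"
      using iso bounded_operators_isometries by blast
    fix x y assume xy: "x \<in> X" "y \<in> Y"
    have "cinner (blinfun_apply (S - T) x) y = cinner (blinfun_apply S x - blinfun_apply R x) y"
      by (simp add: blinfun.diff_left cinner_diff_left R(2)[OF xy])
    also have "cmod \<dots> \<le> norm (blinfun_apply S x - blinfun_apply R x) * norm y"
      by (rule cmod_cinner_le)
    also have "\<dots> \<le> norm (blinfun_apply S x - blinfun_apply R x) * b"
      using b(2)[OF xy(2)] by (intro mult_left_mono) auto
    also have "\<dots> < e"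
      using S(3)[OF xy(1)] b(1) by (simp add: field_simps)
    finally show "cmod (cinner (blinfun_apply (S - T) x) y) < e" .
  qed
  then show ?thesis
    using S iso isometries_subset_contractions V'(2) by blast
qed

lemma unitarily_dense_strong:
  fixes W :: "('a::complex_hilbert_space \<Rightarrow>\<^sub>L 'a) set"
  assumes "unitarily_dense_in_isometries W"
    and V: "openin (subtopology strong_operator_topology isometries) V" "V \<noteq> {}"
  shows "W \<inter> unitaries \<inter> V \<noteq> {}"
proof -
  obtain V' where V': "openin strong_operator_topology V'" "V = V' \<inter> isometries"
    using V(1) by (auto simp: openin_subtopology)
  obtain T where T: "T \<in> V'" "T \<in> isometries"
    using V(2) V' by blast
  obtain X e where X: "finite X" "0 < e"
    "\<forall>S. (\<forall>x\<in>X. norm (blinfun_apply S x - blinfun_apply T x) < e) \<longrightarrow> S \<in> V'"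
    by (rule strong_operator_topology_nbhd[OF V'(1) T(1)]) (rule that)
  obtain S where S: "S \<in> W" "S \<in> unitaries"
    "\<And>x. x \<in> X \<Longrightarrow> norm (blinfun_apply S x - blinfun_apply T x) < e"
    using assms(1) X(1,2) T(2) unfolding unitarily_dense_in_isometries_def by (metis IntD1 IntD2)
  then show ?thesis
    using X(3) V'(2) unitaries_subset_isometries by blast
qed

text \<open>On unitaries the strong topology controls the adjoints, because
  \<open>\<parallel>S\<^sup>* x - T\<^sup>* x\<parallel> = \<parallel>(T - S) T\<^sup>* x\<parallel>\<close>.\<close>

lemma unitarily_dense_strong_star:
  fixes W :: "('a::complex_hilbert_space \<Rightarrow>\<^sub>L 'a) set"
  assumes "unitarily_dense_in_isometries W"
    and V: "openin (subtopology strong_star_operator_topology unitaries) V" "V \<noteq> {}"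
  shows "W \<inter> unitaries \<inter> V \<noteq> {}"
proof -
  obtain V' where V': "openin strong_star_operator_topology V'" "V = V' \<inter> unitaries"
    using V(1) by (auto simp: openin_subtopology)
  obtain T where T: "T \<in> V'" "T \<in> unitaries"
    using V(2) V' by blast
  have bT: "T \<in> bounded_operators" and TT: "T o\<^sub>L adjoint_op T = id_blinfun"
    using T(2) by (auto simp: unitaries_def)
  obtain X e where X: "finite X" "0 < e" "\<forall>S\<in>bounded_operators. (\<forall>x\<in>X.
      norm (blinfun_apply (S - T) x, blinfun_apply (adjoint_op (S - T)) x) < e) \<longrightarrow> S \<in> V'"
    by (rule strong_star_operator_topology_nbhd[OF V'(1) T(1)]) (rule that)
  let ?X = "X \<union> blinfun_apply (adjoint_op T) ` X"
  have "finite ?X" "0 < e / 2" "T \<in> isometries"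
    using X T(2) unitaries_subset_isometries by auto
  then obtain S where S: "S \<in> W" "S \<in> unitaries"
    "\<And>x. x \<in> ?X \<Longrightarrow> norm (blinfun_apply S x - blinfun_apply T x) < e / 2"
    using assms(1) unfolding unitarily_dense_in_isometries_def by (metis IntD1 IntD2)
  have bS: "S \<in> bounded_operators" and SS: "adjoint_op S o\<^sub>L S = id_blinfun" "S o\<^sub>L adjoint_op S = id_blinfun"
    using S(2) by (auto simp: unitaries_def)
  have iso: "S \<in> isometries"
    using S(2) unitaries_subset_isometries by blast
  have "S \<in> V'"
  proof (rule X(3)[rule_format, OF bS])
    fix x assume "x \<in> X"
    let ?z = "blinfun_apply (adjoint_op T) x"
    have 1: "blinfun_apply S (blinfun_apply (adjoint_op S) x) = x"
      using arg_cong[OF SS(2), of "\<lambda>S. blinfun_apply S x"] by simp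
    have 2: "blinfun_apply T ?z = x"
      using arg_cong[OF TT, of "\<lambda>S. blinfun_apply S x"] by simp
    have "norm (blinfun_apply (adjoint_op (S - T)) x) =
        norm (blinfun_apply S (blinfun_apply (adjoint_op S) x - ?z))"
      by (simp add: isometriesD(2)[OF iso] adjoint_op_diff[OF bS bT] blinfun.diff_left)
    also have "\<dots> = norm (blinfun_apply S ?z - blinfun_apply T ?z)"
      by (simp add: blinfun.diff_right 1 2 norm_minus_commute)
    also have "\<dots> < e / 2"
      using S(3)[of ?z] \<open>x \<in> X\<close> by simp
    finally have "norm (blinfun_apply (adjoint_op (S - T)) x) < e / 2" .
    moreover have "norm (blinfun_apply (S - T) x) < e / 2"
      using S(3)[of x] \<open>x \<in> X\<close> by (simp add: blinfun.diff_left)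
    ultimately show "norm (blinfun_apply (S - T) x, blinfun_apply (adjoint_op (S - T)) x) < e"
      using norm_Pair_le[of "blinfun_apply (S - T) x" "blinfun_apply (adjoint_op (S - T)) x"] by linarith
  qed
  then show ?thesis
    using S V'(2) by blast
qed

lemma residual_of_countably_many_strongly_open_dense:
  fixes \<W> :: "('a::complex_hilbert_space \<Rightarrow>\<^sub>L 'a) set set"
  assumes inf: "infinite_dimensional TYPE('a)"
    and D: "countable D" "closure D = (UNIV :: 'a set)"
    and \<W>: "countable \<W>" "\<W> \<noteq> {}" "\<And>W. W \<in> \<W> \<Longrightarrow> strongly_open_in_isometries W"
      "\<And>W. W \<in> \<W> \<Longrightarrow> unitarily_dense_in_isometries W"
    and P: "\<And>T. T \<in> isometries \<Longrightarrow> (\<And>W. W \<in> \<W> \<Longrightarrow> T \<in> W) \<Longrightarrow> P T"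
  shows "residual_in (subtopology weak_operator_topology contractions) {T \<in> contractions. P T}"
    and "residual_in (subtopology strong_operator_topology isometries) {T \<in> isometries. P T}"
    and "residual_in (subtopology strong_star_operator_topology unitaries) {T \<in> unitaries. P T}"
proof -
  have W_iso: "W \<subseteq> isometries" if "W \<in> \<W>" for W
    using \<W>(3)[OF that] by (simp add: strongly_open_in_isometries_def)
  show "residual_in (subtopology strong_operator_topology isometries) {T \<in> isometries. P T}"
  proof (rule residual_inI)
    show "U \<inter> V \<noteq> {}" if "U \<in> \<W>" "openin (subtopology strong_operator_topology isometries) V" "V \<noteq> {}" for U V
      using unitarily_dense_strong[OF \<W>(4)[OF that(1)] that(2,3)] by blast
    show "topspace (subtopology strong_operator_topology isometries) \<inter> \<Inter>\<W> \<subseteq> {T \<in> isometries. P T}"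
      using P by (auto simp: strong_operator_topology_topspace)
  qed (use \<W> openin_strong_isometries in \<open>auto simp: strong_operator_topology_topspace\<close>)
  show "residual_in (subtopology strong_star_operator_topology unitaries) {T \<in> unitaries. P T}"
  proof (rule residual_inI)
    let ?O = "(\<lambda>W. W \<inter> unitaries) ` \<W>"
    show "U \<inter> V \<noteq> {}" if "U \<in> ?O" "openin (subtopology strong_star_operator_topology unitaries) V" "V \<noteq> {}" for U V
      using unitarily_dense_strong_star[OF \<W>(4) that(2,3)] that(1) by blast
    show "topspace (subtopology strong_star_operator_topology unitaries) \<inter> \<Inter>?O \<subseteq> {T \<in> unitaries. P T}"
      using P unitaries_subset_isometries by auto
    show "{T \<in> unitaries. P T} \<subseteq> topspace (subtopology strong_star_operator_topology (unitaries :: ('a \<Rightarrow>\<^sub>L 'a) set))"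
      by (auto simp: strong_star_operator_topology_topspace unitaries_def)
  qed (use \<W> openin_strong_star_unitaries in auto)
  have "\<exists>U. openin (subtopology weak_operator_topology contractions) U \<and> U \<inter> isometries = W" if W: "W \<in> \<W>" for W
  proof -
    obtain U where "openin weak_operator_topology U" "W = U \<inter> isometries"
      using openin_weak_isometries[OF \<W>(3)[OF W]] by (auto simp: openin_subtopology)
    then show ?thesis
      using isometries_subset_contractions
      by (intro exI[of _ "U \<inter> contractions"]) (auto simp: openin_subtopology)
  qed
  then obtain u where u: "\<And>W. W \<in> \<W> \<Longrightarrow> openin (subtopology weak_operator_topology contractions) (u W)"
    "\<And>W. W \<in> \<W> \<Longrightarrow> u W \<inter> isometries = W"
    by metis
  define N where "N = (\<lambda>(x :: 'a, k). {T \<in> contractions. norm x - inverse (real (Suc k)) < norm (blinfun_apply T x)})"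
  show "residual_in (subtopology weak_operator_topology contractions) {T \<in> contractions. P T}"
  proof (rule residual_inI)
    let ?O = "u ` \<W> \<union> N ` (D \<times> UNIV)"
    show "{T \<in> contractions. P T} \<subseteq> topspace (subtopology weak_operator_topology contractions)"
      by (auto simp: weak_operator_topology_topspace contractions_def)
    show "countable ?O"
      using \<W>(1) D(1) by auto
    show "openin (subtopology weak_operator_topology contractions) U" if "U \<in> ?O" for U
      using that u(1) openin_weak_norm_greater by (auto simp: N_def)
    show "U \<inter> V \<noteq> {}" if U: "U \<in> ?O" and "openin (subtopology weak_operator_topology contractions) V" "V \<noteq> {}" for U V
    proof -
      obtain W where W: "W \<in> \<W>" "W \<subseteq> U"
      proof (cases "U \<in> u ` \<W>")
        case False
        then have "isometries \<subseteq> U"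
          using U isometries_subset_contractions by (auto simp: N_def isometriesD(2))
        then show thesis
          using that \<W>(2) W_iso by blast
      qed (use u(2) in blast)
      then show ?thesis
        using unitarily_dense_weak[OF inf \<W>(4)[OF W(1)] that(2,3)] by blast
    qed
    show "topspace (subtopology weak_operator_topology contractions) \<inter> \<Inter>?O \<subseteq> {T \<in> contractions. P T}"
    proof
      fix T assume "T \<in> topspace (subtopology weak_operator_topology contractions) \<inter> \<Inter>?O"
      then have T: "T \<in> contractions" "\<And>W. W \<in> \<W> \<Longrightarrow> T \<in> u W" "\<And>x k. x \<in> D \<Longrightarrow> T \<in> N (x, k)"
        by auto
      have "norm x \<le> norm (blinfun_apply T x)" if "x \<in> D" for x
      proof (rule ccontr)
        assume "\<not> norm x \<le> norm (blinfun_apply T x)"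
        then obtain k where "inverse (real (Suc k)) < norm x - norm (blinfun_apply T x)"
          using reals_Archimedean[of "norm x - norm (blinfun_apply T x)"] by auto
        then show False
          using T(3)[OF that, of k] by (simp add: N_def)
      qed
      then have "D \<subseteq> {x. norm x \<le> norm (blinfun_apply T x)}"
        by blast
      moreover have "closed {x. norm x \<le> norm (blinfun_apply T x)}"
        by (intro closed_Collect_le continuous_intros)
      ultimately have "norm x \<le> norm (blinfun_apply T x)" for x
        using closure_minimal[of D] D(2) by blast
      moreover have "norm (blinfun_apply T x) \<le> norm x" for x
        using T(1) norm_power_op_le[of T 1] by (simp add: contractions_def)
      ultimately have iso: "T \<in> isometries"
        using T(1) by (simp add: isometries_def contractions_def order_antisym)
      have "T \<in> W" if "W \<in> \<W>" for W
        using u(2)[OF that] T(2)[OF that] iso by blast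
      then show "T \<in> {T \<in> contractions. P T}"
        using P[OF iso] T(1) by simp
    qed
  qed
qed

section \<open>Convergence along a set of density one\<close>

text \<open>The Koopman-von Neumann lemma. With \<open>C n\<close> the supremum of the means from \<open>n\<close> on,
  the set of those \<open>n\<close> with \<open>b n \<le> sqrt (C n)\<close> has density one: as \<open>C\<close> decreases, every
  exception \<open>n \<le> N\<close> contributes at least \<open>sqrt (C N)\<close> to a sum that is at most \<open>N * C N\<close>.\<close>

lemma convergence_along_density_one:
  fixes b :: "nat \<Rightarrow> real"
  assumes b: "\<And>n. 0 \<le> b n" "\<And>n. b n \<le> 1"
    and lim: "(\<lambda>N. (\<Sum>n=1..N. b n) / real N) \<longlonglongrightarrow> 0"
  obtains s :: "nat \<Rightarrow> nat" where "\<And>j. 1 \<le> s j" "strict_mono s" "has_density (range s) 1"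
    "(\<lambda>j. b (s j)) \<longlonglongrightarrow> 0"
proof -
  define avg where "avg N = (\<Sum>n=1..N. b n) / real N" for N
  define C where "C n = (SUP N\<in>{n..}. avg N)" for n
  have avg: "0 \<le> avg N" "avg N \<le> 1" for N
  proof -
    have "(\<Sum>n=1..N. b n) \<le> (\<Sum>n=1..N. 1)"
      by (intro sum_mono b)
    then show "avg N \<le> 1"
      by (cases "N = 0") (auto simp: avg_def)
    show "0 \<le> avg N"
      unfolding avg_def by (intro divide_nonneg_nonneg sum_nonneg b) auto
  qed
  have bdd: "bdd_above (avg ` A)" for A
    using avg by (intro bdd_aboveI[of _ 1]) auto
  have avg_le: "avg N \<le> C N" for N
    unfolding C_def by (intro cSUP_upper bdd) auto
  have C_mono: "C N \<le> C n" if "n \<le> N" for n N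
    unfolding C_def using that by (intro cSUP_subset_mono bdd) auto
  have C_nonneg: "0 \<le> C n" for n
    using avg(1) avg_le order_trans by blast
  have C0: "C \<longlonglongrightarrow> 0"
  proof (rule LIMSEQ_I)
    fix r :: real assume "0 < r"
    then obtain n0 where n0: "\<And>N. N \<ge> n0 \<Longrightarrow> norm (avg N - 0) < r / 2"
      using LIMSEQ_D[OF lim[folded avg_def], of "r / 2"] by auto
    have "norm (C n - 0) < r" if "n \<ge> n0" for n
    proof -
      have "C n \<le> r / 2"
        unfolding C_def
      proof (intro cSUP_least)
        show "avg N \<le> r / 2" if "N \<in> {n..}" for N
          using n0[of N] that \<open>n \<ge> n0\<close> by auto
      qed auto
      then show ?thesis
        using C_nonneg[of n] \<open>0 < r\<close> by simp
    qed
    then show "\<exists>no. \<forall>n\<ge>no. norm (C n - 0) < r" by blast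
  qed
  define M where "M = {n. 1 \<le> n \<and> b n \<le> sqrt (C n)}"
  have card_le: "card ({1..N} - M) \<le> N * sqrt (C N)" for N
  proof -
    let ?E = "{1..N} - M"
    have exc: "sqrt (C N) < b n" if "n \<in> ?E" for n
    proof -
      have "sqrt (C N) \<le> sqrt (C n)"
        using C_mono[of n N] that by simp
      moreover have "sqrt (C n) < b n"
        using that by (auto simp: M_def)
      ultimately show ?thesis
        by linarith
    qed
    have "N * avg N \<le> N * C N"
      using avg_le by (intro mult_left_mono) auto
    then have sum: "(\<Sum>n=1..N. b n) \<le> N * C N"
      by (cases "N = 0") (auto simp: avg_def)
    have E_sum: "(\<Sum>n\<in>?E. b n) \<le> (\<Sum>n=1..N. b n)"
      by (intro sum_mono2) (auto simp: b)
    show ?thesis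
    proof (cases "C N = 0")
      case True
      have "?E = {}"
      proof (rule ccontr)
        assume "?E \<noteq> {}"
        then obtain n where n: "n \<in> ?E" by blast
        have "b n \<le> (\<Sum>n\<in>?E. b n)"
          using n by (intro member_le_sum) (auto simp: b)
        then show False
          using exc[OF n] E_sum sum True by simp
      qed
      then show ?thesis
        using True by simp
    next
      case False
      have "card ?E * sqrt (C N) = (\<Sum>n\<in>?E. sqrt (C N))"
        by simp
      also have "\<dots> \<le> (\<Sum>n\<in>?E. b n)"
        using exc by (intro sum_mono) (auto intro: less_imp_le)
      also have "\<dots> \<le> N * sqrt (C N) * sqrt (C N)"
        using E_sum sum C_nonneg[of N] by (simp add: mult.assoc)
      finally show ?thesis
        using False C_nonneg[of N] by simp
    qed
  qed
  have card_M: "card (M \<inter> {1..N}) + card ({1..N} - M) = N" for N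
  proof -
    have "card ((M \<inter> {1..N}) \<union> ({1..N} - M)) = card (M \<inter> {1..N}) + card ({1..N} - M)"
      by (rule card_Un_disjoint) auto
    moreover have "(M \<inter> {1..N}) \<union> ({1..N} - M) = {1..N}"
      by auto
    ultimately show ?thesis
      by simp
  qed
  have dens: "has_density M 1"
    unfolding has_density_def
  proof (rule real_tendsto_sandwich)
    show "(\<lambda>N. 1 - sqrt (C N)) \<longlonglongrightarrow> 1"
      using tendsto_diff[OF tendsto_const tendsto_real_sqrt[OF C0], of 1] by simp
    show "\<forall>\<^sub>F N in sequentially. 1 - sqrt (C N) \<le> card (M \<inter> {1..N}) / N"
      using eventually_gt_at_top[of 0]
    proof eventually_elim
      case (elim N)
      have "real N - N * sqrt (C N) \<le> card (M \<inter> {1..N})"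
        using card_le[of N] card_M[of N] by linarith
      then have "(1 - sqrt (C N)) * N \<le> card (M \<inter> {1..N})"
        by (simp add: algebra_simps)
      then show ?case
        using elim by (simp add: pos_le_divide_eq)
    qed
    show "\<forall>\<^sub>F N in sequentially. card (M \<inter> {1..N}) / N \<le> 1"
      using eventually_gt_at_top[of 0]
    proof eventually_elim
      case (elim N)
      have "real (card (M \<inter> {1..N})) \<le> N"
        using card_M[of N] by linarith
      then show ?case
        using elim by simp
    qed
  qed simp
  have "infinite M"
  proof
    assume fin: "finite M"
    have "(\<lambda>N. card (M \<inter> {1..N}) / N) \<longlonglongrightarrow> 0"
    proof (rule real_tendsto_sandwich[where f = "\<lambda>_. 0"])
      show "(\<lambda>N. card M / N) \<longlonglongrightarrow> 0"
        by (rule lim_const_over_n)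
      show "\<forall>\<^sub>F N in sequentially. card (M \<inter> {1..N}) / N \<le> card M / N"
        using fin by (intro always_eventually allI divide_right_mono) (auto intro: card_mono)
    qed auto
    then show False
      using dens LIMSEQ_unique unfolding has_density_def by fastforce
  qed
  show thesis
  proof
    let ?s = "enumerate M"
    have mem: "?s j \<in> M" for j
      using \<open>infinite M\<close> by (rule enumerate_in_set)
    show "strict_mono ?s"
      using \<open>infinite M\<close> by (rule strict_mono_enumerate)
    then have "filterlim ?s at_top sequentially"
      by (rule filterlim_subseq)
    show "1 \<le> ?s j" for j
      using mem[of j] by (simp add: M_def)
    show "has_density (range ?s) 1"
      using dens range_enumerate[OF \<open>infinite M\<close>] by simp
    show "(\<lambda>j. b (?s j)) \<longlonglongrightarrow> 0"
    proof (rule real_tendsto_sandwich[where f = "\<lambda>_. 0"])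
      have "(\<lambda>n. sqrt (C n)) \<longlonglongrightarrow> 0"
        using tendsto_real_sqrt[OF C0] by simp
      then show "(\<lambda>j. sqrt (C (?s j))) \<longlonglongrightarrow> 0"
        by (rule filterlim_compose) fact
      show "\<forall>\<^sub>F j in sequentially. b (?s j) \<le> sqrt (C (?s j))"
        using mem by (simp add: M_def)
    qed (simp_all add: b)
  qed
qed

text \<open>A weighted sum of the truncated sequences reduces countably many sequences to one.\<close>

lemma joint_convergence_along_density_one:
  fixes a :: "nat \<Rightarrow> nat \<Rightarrow> real"
  assumes a: "\<And>k n. 0 \<le> a k n"
    and lim: "\<And>k. (\<lambda>N. (\<Sum>n=1..N. a k n) / real N) \<longlonglongrightarrow> 0"
  obtains s :: "nat \<Rightarrow> nat" where "\<And>j. 1 \<le> s j" "strict_mono s" "has_density (range s) 1"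
    "\<And>k. (\<lambda>j. a k (s j)) \<longlonglongrightarrow> 0"
proof -
  define w :: "nat \<Rightarrow> real" where "w k = (1/2) ^ Suc k" for k
  have w: "w sums 1" "\<And>k. 0 < w k"
    using power_half_series by (simp_all add: w_def[abs_def])
  define c where "c k n = w k * min 1 (a k n)" for k n
  have c: "0 \<le> c k n" "c k n \<le> w k" for k n
    using a w(2)[of k] by (auto simp: c_def)
  have summable: "summable (\<lambda>k. c k n)" for n
    by (rule summable_comparison_test[OF _ sums_summable[OF w(1)]]) (use c in auto)
  define b where "b n = (\<Sum>k. c k n)" for n
  have b: "0 \<le> b n" "b n \<le> 1" for n
    using suminf_nonneg[OF summable c(1)] suminf_le[OF c(2) summable sums_summable[OF w(1)]]
      sums_unique[OF w(1)] by (auto simp: b_def)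
  define m where "m k N = (\<Sum>n=1..N. c k n) / real N" for k N
  have m0: "0 \<le> m k N" for k N
    unfolding m_def by (intro divide_nonneg_nonneg sum_nonneg c) auto
  have mw: "m k N \<le> w k" for k N
  proof -
    have "(\<Sum>n=1..N. c k n) \<le> (\<Sum>n=1..N. w k)"
      by (intro sum_mono c)
    then show ?thesis
      using w(2)[of k] by (cases "N = 0") (auto simp: m_def field_simps)
  qed
  have "(\<lambda>N. m k N) \<longlonglongrightarrow> 0" for k
  proof (rule real_tendsto_sandwich[where f = "\<lambda>_. 0"])
    show "(\<lambda>N. w k * ((\<Sum>n=1..N. a k n) / real N)) \<longlonglongrightarrow> 0"
      using tendsto_mult_left[OF lim, of "w k" k] by simp
    have "(\<Sum>n=1..N. c k n) \<le> w k * (\<Sum>n=1..N. a k n)" for N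
      unfolding sum_distrib_left c_def using w(2)[of k] by (intro sum_mono mult_left_mono) auto
    then show "\<forall>\<^sub>F N in sequentially. m k N \<le> w k * ((\<Sum>n=1..N. a k n) / real N)"
      by (auto simp: m_def divide_right_mono)
  qed (use m0 in auto)
  moreover have "\<forall>\<^sub>F (k, N) in at_top \<times>\<^sub>F sequentially. norm (m k N) \<le> w k"
    using m0 mw by (intro always_eventually) auto
  ultimately have "(\<lambda>N. \<Sum>k. m k N) \<longlonglongrightarrow> (\<Sum>k. 0)"
    using tannerys_theorem[of m "\<lambda>_. 0" sequentially w] sums_summable[OF w(1)] by simp
  moreover have "(\<Sum>k. m k N) = (\<Sum>n=1..N. b n) / real N" for N
    unfolding m_def b_def using summable
    by (subst suminf_divide) (auto simp: suminf_sum intro!: summable_sum)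
  ultimately have "(\<lambda>N. (\<Sum>n=1..N. b n) / real N) \<longlonglongrightarrow> 0"
    by simp
  then obtain s :: "nat \<Rightarrow> nat" where s: "\<And>j. 1 \<le> s j" "strict_mono s" "has_density (range s) 1"
    "(\<lambda>j. b (s j)) \<longlonglongrightarrow> 0"
    using convergence_along_density_one[of b, OF b] by blast
  have "(\<lambda>j. a k (s j)) \<longlonglongrightarrow> 0" for k
  proof -
    have "c k n \<le> b n" for n
      unfolding b_def using sum_le_suminf[OF summable, of "{k}"] c(1) by simp
    then have "(\<lambda>j. c k (s j)) \<longlonglongrightarrow> 0"
      using c(1) by (intro real_tendsto_sandwich[OF _ _ tendsto_const s(4)]) auto
    then have "(\<lambda>j. c k (s j) / w k) \<longlonglongrightarrow> 0"
      using tendsto_divide[OF _ tendsto_const, of _ 0 _ "w k"] w(2)[of k] by fastforce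
    then have min: "(\<lambda>j. min 1 (a k (s j))) \<longlonglongrightarrow> 0"
      using w(2)[of k] by (simp add: c_def)
    then have "\<forall>\<^sub>F j in sequentially. min 1 (a k (s j)) < 1"
      by (rule order_tendstoD) simp
    then have "\<forall>\<^sub>F j in sequentially. min 1 (a k (s j)) = a k (s j)"
      by (rule eventually_mono) auto
    with min show ?thesis
      by (rule Lim_transform_eventually)
  qed
  with s(1-3) show thesis
    by (rule that)
qed


section \<open>The two properties as countable intersections\<close>

text \<open>The bound is uniform in \<open>y\<close>, so that it can be applied to the images of \<open>y\<close> under powers of the
  adjoint, and one \<open>N\<close> then controls all later means; the margin between \<open>c\<close> and \<open>e\<close> makes the
  condition open.\<close>

definition small_mean_isometries :: "'a::complex_inner \<Rightarrow> real \<Rightarrow> ('a \<Rightarrow>\<^sub>L 'a) set" where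
  "small_mean_isometries x e = {T \<in> isometries. \<exists>N\<ge>1. \<exists>c<e. \<forall>y.
     (\<Sum>n=1..N. (cmod (cinner (blinfun_apply (power_op T n) x) y))\<^sup>2) \<le> c * real N * (norm y)\<^sup>2}"

definition almost_scalar_power_isometries ::
  "complex \<Rightarrow> 'a::complex_inner set \<Rightarrow> real \<Rightarrow> nat \<Rightarrow> ('a \<Rightarrow>\<^sub>L 'a) set" where
  "almost_scalar_power_isometries l X e m = {T \<in> isometries. \<exists>n\<ge>m. \<forall>x\<in>X.
     norm (blinfun_apply (power_op T n) x - l *\<^sub>C x) < e}"

lemma norm_power_op_diff_le:
  assumes "S \<in> isometries"
  shows "norm (blinfun_apply (power_op S n) x - blinfun_apply (power_op T n) x) \<le>
    (\<Sum>k<n. norm (blinfun_apply S (blinfun_apply (power_op T k) x) -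
      blinfun_apply T (blinfun_apply (power_op T k) x)))"
proof (induction n)
  case (Suc n)
  let ?s = "blinfun_apply (power_op S n) x" and ?t = "blinfun_apply (power_op T n) x"
  have "blinfun_apply S ?s - blinfun_apply T ?t =
      blinfun_apply S (?s - ?t) + (blinfun_apply S ?t - blinfun_apply T ?t)"
    by (simp add: blinfun.diff_right)
  then have "norm (blinfun_apply S ?s - blinfun_apply T ?t) \<le>
      norm (?s - ?t) + norm (blinfun_apply S ?t - blinfun_apply T ?t)"
    using norm_triangle_ineq isometriesD(2)[OF assms] by metis
  with Suc show ?case by simp
qed simp

lemma powers_strongly_continuous:
  assumes "finite X" "0 < d"
  obtains Y e where "finite Y" "0 < e"
    "\<forall>S\<in>isometries. (\<forall>y\<in>Y. norm (blinfun_apply S y - blinfun_apply T y) < e) \<longrightarrow>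
      (\<forall>x\<in>X. \<forall>n\<le>N. norm (blinfun_apply (power_op S n) x - blinfun_apply (power_op T n) x) < d)"
proof
  let ?Y = "(\<lambda>(x, k). blinfun_apply (power_op T k) x) ` (X \<times> {..<N})"
  let ?e = "d / (real N + 1)"
  show "finite ?Y" "0 < ?e"
    using assms by auto
  show "\<forall>S\<in>isometries. (\<forall>y\<in>?Y. norm (blinfun_apply S y - blinfun_apply T y) < ?e) \<longrightarrow>
      (\<forall>x\<in>X. \<forall>n\<le>N. norm (blinfun_apply (power_op S n) x - blinfun_apply (power_op T n) x) < d)"
  proof (intro ballI impI allI)
    fix S x n
    assume S: "S \<in> isometries" "\<forall>y\<in>?Y. norm (blinfun_apply S y - blinfun_apply T y) < ?e"
      and "x \<in> X" "n \<le> N"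
    have "norm (blinfun_apply (power_op S n) x - blinfun_apply (power_op T n) x) \<le> (\<Sum>k<n. ?e)"
    proof (rule order_trans[OF norm_power_op_diff_le[OF S(1)]], rule sum_mono)
      fix k assume "k \<in> {..<n}"
      then have "blinfun_apply (power_op T k) x \<in> ?Y"
        using \<open>x \<in> X\<close> \<open>n \<le> N\<close> by force
      then show "norm (blinfun_apply S (blinfun_apply (power_op T k) x) -
          blinfun_apply T (blinfun_apply (power_op T k) x)) \<le> ?e"
        using S(2) less_imp_le by blast
    qed
    also have "\<dots> \<le> real N * ?e"
      using \<open>n \<le> N\<close> assms(2) by (simp add: divide_right_mono mult_right_mono)
    also have "\<dots> < d"
      using assms(2) by (simp add: field_simps)
    finally show "norm (blinfun_apply (power_op S n) x - blinfun_apply (power_op T n) x) < d" .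
  qed
qed

lemma strongly_open_almost_scalar_power:
  assumes "finite X"
  shows "strongly_open_in_isometries (almost_scalar_power_isometries l X e m)"
  unfolding strongly_open_in_isometries_def
proof (intro conjI ballI)
  fix T assume "T \<in> almost_scalar_power_isometries l X e m"
  then obtain n where n: "n \<ge> m" "\<And>x. x \<in> X \<Longrightarrow> norm (blinfun_apply (power_op T n) x - l *\<^sub>C x) < e"
    by (auto simp: almost_scalar_power_isometries_def)
  define d where "d = Min (insert 1 ((\<lambda>x. e - norm (blinfun_apply (power_op T n) x - l *\<^sub>C x)) ` X))"
  have "0 < d"
    using assms n(2) by (simp add: d_def)
  have d: "d \<le> e - norm (blinfun_apply (power_op T n) x - l *\<^sub>C x)" if "x \<in> X" for x
    unfolding d_def using assms that by (intro Min_le) auto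
  obtain Y e' where Y: "finite Y" "0 < e'"
    "\<forall>S\<in>isometries. (\<forall>y\<in>Y. norm (blinfun_apply S y - blinfun_apply T y) < e') \<longrightarrow>
      (\<forall>x\<in>X. \<forall>k\<le>n. norm (blinfun_apply (power_op S k) x - blinfun_apply (power_op T k) x) < d)"
    by (rule powers_strongly_continuous[OF assms \<open>0 < d\<close>])
  have "S \<in> almost_scalar_power_isometries l X e m"
    if S: "S \<in> isometries" "\<forall>y\<in>Y. norm (blinfun_apply S y - blinfun_apply T y) < e'" for S
  proof -
    have "norm (blinfun_apply (power_op S n) x - l *\<^sub>C x) < e" if "x \<in> X" for x
    proof -
      have "norm (blinfun_apply (power_op S n) x - blinfun_apply (power_op T n) x) < d"
        using Y(3) S that by blast
      then show ?thesis
        using d[OF that] norm_triangle_ineq[of "blinfun_apply (power_op S n) x - blinfun_apply (power_op T n) x"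
            "blinfun_apply (power_op T n) x - l *\<^sub>C x"] by simp
    qed
    then show ?thesis
      using S(1) n(1) by (auto simp: almost_scalar_power_isometries_def)
  qed
  then show "\<exists>Y e'. finite Y \<and> 0 < e' \<and> (\<forall>S\<in>isometries.
      (\<forall>y\<in>Y. norm (blinfun_apply S y - blinfun_apply T y) < e') \<longrightarrow>
      S \<in> almost_scalar_power_isometries l X e m)"
    using Y(1,2) by blast
qed (auto simp: almost_scalar_power_isometries_def)

lemma strongly_open_small_mean:
  "strongly_open_in_isometries (small_mean_isometries x e)"
  unfolding strongly_open_in_isometries_def
proof (intro conjI ballI)
  fix T assume "T \<in> small_mean_isometries x e"
  then obtain N c where T: "T \<in> isometries" and N: "N \<ge> 1" "c < e"
    "\<And>y. (\<Sum>n=1..N. (cmod (cinner (blinfun_apply (power_op T n) x) y))\<^sup>2) \<le> c * real N * (norm y)\<^sup>2"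
    by (auto simp: small_mean_isometries_def)
  define c' where "c' = (c + e) / 2"
  have c': "c < c'" "c' < e"
    using N(2) by (auto simp: c'_def)
  define d where "d = min 1 ((c' - c) / (2 * norm x + 1))"
  have "0 < d"
    using c' by (simp add: d_def add_nonneg_pos)
  have "d * (2 * norm x + 1) \<le> (c' - c) / (2 * norm x + 1) * (2 * norm x + 1)"
    by (intro mult_right_mono) (auto simp: d_def)
  also have "\<dots> = c' - c"
    using norm_ge_zero[of x] by (simp add: add_nonneg_eq_0_iff)
  finally have "d * (2 * norm x + 1) \<le> c' - c" .
  moreover have "d * d \<le> d * 1"
    using \<open>0 < d\<close> by (intro mult_left_mono) (auto simp: d_def)
  ultimately have d: "c + 2 * norm x * d + d\<^sup>2 \<le> c'"
    by (simp add: power2_eq_square algebra_simps)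
  obtain Y e' where Y: "finite Y" "0 < e'"
    "\<forall>S\<in>isometries. (\<forall>y\<in>Y. norm (blinfun_apply S y - blinfun_apply T y) < e') \<longrightarrow>
      (\<forall>x\<in>{x}. \<forall>n\<le>N. norm (blinfun_apply (power_op S n) x - blinfun_apply (power_op T n) x) < d)"
    by (rule powers_strongly_continuous[OF _ \<open>0 < d\<close>, of "{x}"]) auto
  have "S \<in> small_mean_isometries x e"
    if S: "S \<in> isometries" "\<forall>y\<in>Y. norm (blinfun_apply S y - blinfun_apply T y) < e'" for S
  proof -
    have "(\<Sum>n=1..N. (cmod (cinner (blinfun_apply (power_op S n) x) y))\<^sup>2) \<le> c' * real N * (norm y)\<^sup>2" for y
    proof -
      have "(cmod (cinner (blinfun_apply (power_op S n) x) y))\<^sup>2 \<le>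
          (cmod (cinner (blinfun_apply (power_op T n) x) y))\<^sup>2 + (2 * norm x * d + d\<^sup>2) * (norm y)\<^sup>2"
        if "n \<in> {1..N}" for n
      proof -
        let ?s = "blinfun_apply (power_op S n) x" and ?t = "blinfun_apply (power_op T n) x"
        have "norm (?s - ?t) < d"
          using Y(3) S that by simp
        then have "cmod (cinner (?s - ?t) y) \<le> d * norm y"
          using cmod_cinner_le[of "?s - ?t" y] mult_right_mono[of "norm (?s - ?t)" d "norm y"] by simp
        moreover have "cinner ?s y = cinner (?s - ?t) y + cinner ?t y"
          by (simp add: cinner_diff_left)
        then have "cmod (cinner ?s y) \<le> cmod (cinner (?s - ?t) y) + cmod (cinner ?t y)"
          by (metis norm_triangle_ineq)
        ultimately have "cmod (cinner ?s y) \<le> cmod (cinner ?t y) + d * norm y"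
          by linarith
        then have "(cmod (cinner ?s y))\<^sup>2 \<le> (cmod (cinner ?t y) + d * norm y)\<^sup>2"
          by (intro power_mono) auto
        also have "\<dots> = (cmod (cinner ?t y))\<^sup>2 + 2 * d * norm y * cmod (cinner ?t y) + d\<^sup>2 * (norm y)\<^sup>2"
          by (simp add: power2_sum power_mult_distrib algebra_simps)
        also have "2 * d * norm y * cmod (cinner ?t y) \<le> 2 * d * norm y * (norm x * norm y)"
          using cmod_cinner_le[of ?t y] isometriesD(2)[OF power_op_isometry[OF T]] \<open>0 < d\<close>
          by (intro mult_left_mono) auto
        finally show ?thesis
          by (simp add: algebra_simps power2_eq_square)
      qed
      then have "(\<Sum>n=1..N. (cmod (cinner (blinfun_apply (power_op S n) x) y))\<^sup>2) \<le>
          (\<Sum>n=1..N. (cmod (cinner (blinfun_apply (power_op T n) x) y))\<^sup>2 + (2 * norm x * d + d\<^sup>2) * (norm y)\<^sup>2)"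
        by (rule sum_mono)
      also have "\<dots> \<le> c * real N * (norm y)\<^sup>2 + real N * ((2 * norm x * d + d\<^sup>2) * (norm y)\<^sup>2)"
        using N(3)[of y] by (simp add: sum.distrib)
      also have "\<dots> = (c + 2 * norm x * d + d\<^sup>2) * (real N * (norm y)\<^sup>2)"
        by (simp add: algebra_simps)
      also have "\<dots> \<le> c' * (real N * (norm y)\<^sup>2)"
        using d by (intro mult_right_mono) auto
      finally show ?thesis
        by (simp add: mult.assoc)
    qed
    then show ?thesis
      using S(1) N(1) c'(2) by (auto simp: small_mean_isometries_def)
  qed
  then show "\<exists>Y e'. finite Y \<and> 0 < e' \<and> (\<forall>S\<in>isometries.
      (\<forall>y\<in>Y. norm (blinfun_apply S y - blinfun_apply T y) < e') \<longrightarrow> S \<in> small_mean_isometries x e)"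
    using Y(1,2) by blast
qed (auto simp: small_mean_isometries_def)

lemma unitarily_dense_small_mean:
  assumes inf: "infinite_dimensional TYPE('a::complex_hilbert_space)" and "0 < e"
  shows "unitarily_dense_in_isometries (small_mean_isometries (x :: 'a) e)"
  unfolding unitarily_dense_in_isometries_def
proof (intro ballI allI impI)
  fix T :: "'a \<Rightarrow>\<^sub>L 'a" and X :: "'a set" and d :: real
  assume T: "T \<in> isometries" "finite X" "0 < d"
  define r where "r = min d (e / 2)"
  have r: "0 < r" "r \<le> d" "r < e"
    using assms T by (auto simp: r_def)
  have fin: "finite (insert x X)"
    using T by simp
  obtain S where S: "S \<in> unitaries"
    "\<And>y. y \<in> insert x X \<Longrightarrow> norm (blinfun_apply S y - blinfun_apply T y) < r"
    "\<exists>N\<ge>1. \<forall>x\<in>insert x X. \<forall>y. (\<Sum>n=1..N. (cmod (cinner (blinfun_apply (power_op S n) x) y))\<^sup>2) \<le>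
       r * real N * (norm y)\<^sup>2"
    using approximation_by_cyclic_shift[OF inf T(1) fin r(1) norm_one] by metis
  then have "S \<in> small_mean_isometries x e"
    using r(3) unitaries_subset_isometries unfolding small_mean_isometries_def by blast
  then show "\<exists>S\<in>small_mean_isometries x e \<inter> unitaries. \<forall>y\<in>X. norm (blinfun_apply S y - blinfun_apply T y) < d"
    using S(1,2) r(2) by (meson IntI insertI2 less_le_trans)
qed

lemma unitarily_dense_almost_scalar_power:
  assumes inf: "infinite_dimensional TYPE('a::complex_hilbert_space)"
    and "0 < e" "finite X" "cmod l = 1"
  shows "unitarily_dense_in_isometries (almost_scalar_power_isometries l (X :: 'a set) e m)"
  unfolding unitarily_dense_in_isometries_def
proof (intro ballI allI impI)
  fix T :: "'a \<Rightarrow>\<^sub>L 'a" and Y :: "'a set" and d :: real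
  assume T: "T \<in> isometries" "finite Y" "0 < d"
  have fin: "finite (X \<union> Y)"
    using T assms by simp
  obtain S where S: "S \<in> unitaries"
    "\<And>y. y \<in> X \<union> Y \<Longrightarrow> norm (blinfun_apply S y - blinfun_apply T y) < d"
    "\<exists>n\<ge>m. \<forall>x\<in>X \<union> Y. blinfun_apply (power_op S n) x = l *\<^sub>C x"
    using approximation_by_cyclic_shift[OF inf T(1) fin T(3) assms(4)] by metis
  then have "S \<in> almost_scalar_power_isometries l X e m"
    using assms(2) unitaries_subset_isometries unfolding almost_scalar_power_isometries_def by fastforce
  then show "\<exists>S\<in>almost_scalar_power_isometries l X e m \<inter> unitaries.
      \<forall>y\<in>Y. norm (blinfun_apply S y - blinfun_apply T y) < d"
    using S(1,2) by blast
qed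

text \<open>A single good \<open>N\<close> controls all later means: splitting off blocks of length \<open>N\<close> moves powers of
  \<open>T\<close> to the other argument as powers of the adjoint, which does not increase norms, and the bound
  is uniform in that argument.\<close>

lemma small_mean_eventually:
  fixes T :: "'a::complex_hilbert_space \<Rightarrow>\<^sub>L 'a"
  assumes T: "T \<in> contractions" and "1 \<le> N" "0 \<le> c"
    and N: "\<And>y. (\<Sum>n=1..N. (cmod (cinner (blinfun_apply (power_op T n) x) y))\<^sup>2) \<le> c * real N * (norm y)\<^sup>2"
  shows "(\<Sum>n=1..K. (cmod (cinner (blinfun_apply (power_op T n) x) y))\<^sup>2) \<le>
    (c * real K + real N * (norm x)\<^sup>2) * (norm y)\<^sup>2"
proof (induction K arbitrary: y rule: less_induct)
  case (less K)
  have bT: "T \<in> bounded_operators" and nT: "norm T \<le> 1"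
    using T by (auto simp: contractions_def)
  show ?case
  proof (cases "K < N")
    case True
    have "(cmod (cinner (blinfun_apply (power_op T n) x) y))\<^sup>2 \<le> (norm x)\<^sup>2 * (norm y)\<^sup>2" for n
    proof -
      have "cmod (cinner (blinfun_apply (power_op T n) x) y) \<le> norm x * norm y"
        using norm_power_op_le[OF nT, of n x]
        by (intro order_trans[OF cmod_cinner_le] mult_right_mono) auto
      then show ?thesis
        using power_mono[of _ "norm x * norm y" 2] by (simp add: power_mult_distrib)
    qed
    then have "(\<Sum>n=1..K. (cmod (cinner (blinfun_apply (power_op T n) x) y))\<^sup>2) \<le>
        (\<Sum>n=1..K. (norm x)\<^sup>2 * (norm y)\<^sup>2)"
      by (intro sum_mono)
    also have "\<dots> = real K * (norm x)\<^sup>2 * (norm y)\<^sup>2"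
      by simp
    also have "\<dots> \<le> (c * real K + real N * (norm x)\<^sup>2) * (norm y)\<^sup>2"
      using True \<open>0 \<le> c\<close> by (intro mult_right_mono add_increasing) auto
    finally show ?thesis .
  next
    case False
    define L where "L = K - N"
    have K: "K = N + L" "L < K"
      using False \<open>1 \<le> N\<close> by (auto simp: L_def)
    define z where "z = blinfun_apply (adjoint_op (power_op T N)) y"
    have adj: "cinner (blinfun_apply (power_op T N) u) y = cinner u z" for u
      unfolding z_def by (rule cinner_adjoint) (rule bounded_operators_power[OF bT])
    have "norm z * norm z \<le> norm z * norm y"
    proof -
      have "complex_of_real (norm z * norm z) = cinner (blinfun_apply (power_op T N) z) y"
        by (simp add: adj cinner_self power2_eq_square)
      then have "norm z * norm z = cmod (cinner (blinfun_apply (power_op T N) z) y)"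
        by (metis norm_of_real abs_of_nonneg mult_nonneg_nonneg norm_ge_zero)
      also have "\<dots> \<le> norm (blinfun_apply (power_op T N) z) * norm y"
        by (rule cmod_cinner_le)
      also have "\<dots> \<le> norm z * norm y"
        by (intro mult_right_mono norm_power_op_le nT) auto
      finally show ?thesis .
    qed
    then have z: "norm z \<le> norm y"
      by (cases "z = 0") auto
    have "(\<Sum>n=N+1..N+L. (cmod (cinner (blinfun_apply (power_op T n) x) y))\<^sup>2) =
        (\<Sum>n=1..L. (cmod (cinner (blinfun_apply (power_op T n) x) z))\<^sup>2)"
    proof -
      have "(\<Sum>n=N+1..N+L. (cmod (cinner (blinfun_apply (power_op T n) x) y))\<^sup>2) =
          (\<Sum>n=1..L. (cmod (cinner (blinfun_apply (power_op T (N + n)) x) y))\<^sup>2)"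
        using sum.shift_bounds_cl_nat_ivl[of "\<lambda>n. (cmod (cinner (blinfun_apply (power_op T n) x) y))\<^sup>2" 1 N L]
        by (simp add: add.commute)
      then show ?thesis
        by (simp add: power_op_add adj)
    qed
    also have "\<dots> \<le> (c * real L + real N * (norm x)\<^sup>2) * (norm z)\<^sup>2"
      by (rule less.IH[OF K(2)])
    also have "\<dots> \<le> (c * real L + real N * (norm x)\<^sup>2) * (norm y)\<^sup>2"
      using z \<open>0 \<le> c\<close> by (intro mult_left_mono power_mono) auto
    finally have "(\<Sum>n=N+1..N+L. (cmod (cinner (blinfun_apply (power_op T n) x) y))\<^sup>2) \<le>
        (c * real L + real N * (norm x)\<^sup>2) * (norm y)\<^sup>2" .
    moreover have "(\<Sum>n=1..K. (cmod (cinner (blinfun_apply (power_op T n) x) y))\<^sup>2) =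
        (\<Sum>n=1..N. (cmod (cinner (blinfun_apply (power_op T n) x) y))\<^sup>2) +
        (\<Sum>n=N+1..N+L. (cmod (cinner (blinfun_apply (power_op T n) x) y))\<^sup>2)"
      unfolding K(1) by (rule sum.ub_add_nat) simp
    ultimately show ?thesis
      using N[of y] by (simp add: K(1) algebra_simps)
  qed
qed

lemma small_means_tendsto_0:
  fixes T :: "'a::complex_hilbert_space \<Rightarrow>\<^sub>L 'a"
  assumes "\<And>k. T \<in> small_mean_isometries x (inverse (real (Suc k)))"
  shows "(\<lambda>K. (\<Sum>n=1..K. (cmod (cinner (blinfun_apply (power_op T n) x) y))\<^sup>2) / real K) \<longlonglongrightarrow> 0"
proof (rule LIMSEQ_I)
  fix r :: real assume "0 < r"
  \<comment> \<open>The summand \<open>1\<close> avoids a division by \<open>0\<close> for \<open>y = 0\<close>.\<close>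
  define Y where "Y = (norm y)\<^sup>2 + 1"
  have Y: "0 < Y" "(norm y)\<^sup>2 \<le> Y"
    by (auto simp: Y_def add_nonneg_pos)
  obtain k where k: "inverse (real (Suc k)) < r / (2 * Y)"
    using reals_Archimedean[of "r / (2 * Y)"] \<open>0 < r\<close> Y(1) by auto
  obtain N c where T: "T \<in> isometries" and N: "1 \<le> N" "c < inverse (real (Suc k))"
    "\<And>y. (\<Sum>n=1..N. (cmod (cinner (blinfun_apply (power_op T n) x) y))\<^sup>2) \<le> c * real N * (norm y)\<^sup>2"
    using assms[of k] by (auto simp: small_mean_isometries_def)
  have con: "T \<in> contractions"
    using T isometries_subset_contractions by blast
  define c' where "c' = max 0 c"
  have c': "0 \<le> c'" "c' * Y < r / 2"
  proof -
    have "c' < r / (2 * Y)"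
      using k N(2) \<open>0 < r\<close> Y by (simp add: c'_def)
    then show "c' * Y < r / 2"
      using Y(1) by (simp add: field_simps)
  qed (simp add: c'_def)
  have N': "(\<Sum>n=1..N. (cmod (cinner (blinfun_apply (power_op T n) x) y))\<^sup>2) \<le> c' * real N * (norm y)\<^sup>2" for y
    using N(3)[of y] by (rule order_trans) (auto simp: c'_def intro!: mult_right_mono)
  define B where "B = real N * (norm x)\<^sup>2 * Y"
  obtain K0 :: nat where K0: "2 * B / r < K0"
    using reals_Archimedean2 by blast
  have "norm ((\<Sum>n=1..K. (cmod (cinner (blinfun_apply (power_op T n) x) y))\<^sup>2) / real K - 0) < r"
    if "K \<ge> Suc K0" for K
  proof -
    have K: "0 < real K" "2 * B / r < real K"
      using that K0 by linarith+
    let ?s = "\<Sum>n=1..K. (cmod (cinner (blinfun_apply (power_op T n) x) y))\<^sup>2"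
    have "?s \<le> (c' * real K + real N * (norm x)\<^sup>2) * (norm y)\<^sup>2"
      by (rule small_mean_eventually[OF con N(1) c'(1) N'])
    also have "\<dots> \<le> (c' * real K + real N * (norm x)\<^sup>2) * Y"
      using c'(1) Y(2) by (intro mult_left_mono) auto
    also have "\<dots> = c' * Y * real K + B"
      by (simp add: B_def algebra_simps)
    also have "\<dots> < r / 2 * real K + r / 2 * real K"
    proof (rule add_strict_mono)
      show "c' * Y * real K < r / 2 * real K"
        using c'(2) K(1) by (rule mult_strict_right_mono)
      show "B < r / 2 * real K"
        using K(2) \<open>0 < r\<close> by (simp add: field_simps)
    qed
    finally have "?s < r * real K"
      by simp
    then have "?s / real K < r"
      using K(1) by (simp add: pos_divide_less_eq)
    moreover have "0 \<le> ?s / real K"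
      by (intro divide_nonneg_nonneg sum_nonneg) auto
    ultimately show ?thesis
      by simp
  qed
  then show "\<exists>K0. \<forall>K\<ge>K0. norm ((\<Sum>n=1..K. (cmod (cinner (blinfun_apply (power_op T n) x) y))\<^sup>2) / real K - 0) < r"
    by blast
qed

lemma limitin_weak_operator_topology_0I:
  fixes T :: "nat \<Rightarrow> 'a::complex_inner \<Rightarrow>\<^sub>L 'a"
  assumes T: "\<And>j. T j \<in> contractions" and D: "closure D = UNIV"
    and lim: "\<And>x y. x \<in> D \<Longrightarrow> y \<in> D \<Longrightarrow> (\<lambda>j. cinner (blinfun_apply (T j) x) y) \<longlonglongrightarrow> 0"
  shows "limitin weak_operator_topology T 0 sequentially"
  unfolding limitin_def
proof (intro conjI allI impI)
  show "0 \<in> topspace (weak_operator_topology :: ('a \<Rightarrow>\<^sub>L 'a) topology)"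
    by (simp add: weak_operator_topology_topspace bounded_operators_zero)
  have le: "norm (blinfun_apply (T j) x) \<le> norm x" for j x
    using norm_power_op_le[of "T j" 1 x] T[of j] by (simp add: contractions_def)
  have near: "\<exists>z\<in>D. norm (x - z) < e" if "0 < e" for x e
    using that D closure_approachable[of x D] by (auto simp: dist_norm norm_minus_commute)
  have ev: "\<forall>\<^sub>F j in sequentially. cmod (cinner (blinfun_apply (T j) x) y) < e" if "0 < e" for x y e
  proof -
    define r where "r = e / 3"
    have r: "0 < r"
      using that by (simp add: r_def)
    have pos: "0 < norm z + 1" for z :: 'a
      by (simp add: add_nonneg_pos)
    obtain u where u: "u \<in> D" "norm (x - u) < r / (norm y + 1)"
      using near[OF divide_pos_pos[OF r pos[of y]]] by blast
    obtain v where v: "v \<in> D" "norm (y - v) < r / (norm u + 1)"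
      using near[OF divide_pos_pos[OF r pos[of u]]] by blast
    have 1: "norm (x - u) * norm y \<le> r"
    proof -
      have "norm (x - u) * (norm y + 1) < r"
        using u(2) pos_less_divide_eq[OF pos] by blast
      then show ?thesis
        using norm_ge_zero[of "x - u"] by (simp only: distrib_left mult_1_right)
    qed
    have 2: "norm u * norm (y - v) \<le> r"
    proof -
      have "norm (y - v) * (norm u + 1) < r"
        using v(2) pos_less_divide_eq[OF pos] by blast
      then show ?thesis
        using norm_ge_zero[of "y - v"]
        by (simp only: distrib_left mult_1_right mult.commute[of "norm u"])
    qed
    have "\<forall>\<^sub>F j in sequentially. cmod (cinner (blinfun_apply (T j) u) v) < r"
      using tendstoD[OF lim[OF u(1) v(1)] r] by (simp add: dist_norm)
    then show ?thesis
    proof eventually_elim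
      case (elim j)
      have "cinner (blinfun_apply (T j) x) y = cinner (blinfun_apply (T j) (x - u)) y +
          cinner (blinfun_apply (T j) u) (y - v) + cinner (blinfun_apply (T j) u) v"
        by (simp add: blinfun.diff_right cinner_diff_left cinner_diff_right)
      then have "cmod (cinner (blinfun_apply (T j) x) y) \<le> cmod (cinner (blinfun_apply (T j) (x - u)) y) +
          cmod (cinner (blinfun_apply (T j) u) (y - v)) + cmod (cinner (blinfun_apply (T j) u) v)"
        by (simp only:) (intro norm_triangle_mono order_refl)
      moreover have "cmod (cinner (blinfun_apply (T j) (x - u)) y) \<le> norm (x - u) * norm y"
        by (intro order_trans[OF cmod_cinner_le] mult_right_mono le) simp
      moreover have "cmod (cinner (blinfun_apply (T j) u) (y - v)) \<le> norm u * norm (y - v)"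
        by (intro order_trans[OF cmod_cinner_le] mult_right_mono le) simp
      ultimately show ?case
        using 1 2 elim unfolding r_def by linarith
    qed
  qed
  fix U assume U: "openin weak_operator_topology U \<and> (0 :: 'a \<Rightarrow>\<^sub>L 'a) \<in> U"
  obtain X Y e where XY: "finite X" "finite Y" "0 < e" "\<forall>S\<in>bounded_operators.
      (\<forall>x\<in>X. \<forall>y\<in>Y. cmod (cinner (blinfun_apply (S - 0) x) y) < e) \<longrightarrow> S \<in> U"
    by (rule weak_operator_topology_nbhd[OF U[THEN conjunct1] U[THEN conjunct2]]) (rule that)
  have "\<forall>\<^sub>F j in sequentially. \<forall>x\<in>X. \<forall>y\<in>Y. cmod (cinner (blinfun_apply (T j) x) y) < e"
    using XY ev by (intro eventually_ball_finite ballI) auto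
  then show "\<forall>\<^sub>F j in sequentially. T j \<in> U"
    by (rule eventually_mono) (use XY(4) T in \<open>auto simp: contractions_def\<close>)
qed

lemma weakly_stable_if_small_means:
  fixes T :: "'a::complex_hilbert_space \<Rightarrow>\<^sub>L 'a" and d :: "nat \<Rightarrow> 'a"
  assumes "closure (range d) = UNIV"
    and T: "\<And>i k. T \<in> small_mean_isometries (d i) (inverse (real (Suc k)))"
  shows "weakly_stable_along_density_one T"
proof -
  have iso: "T \<in> isometries"
    using T[of 0 0] by (simp add: small_mean_isometries_def)
  define a where "a k n = (cmod (cinner (blinfun_apply (power_op T n) (d (fst (prod_decode k))))
    (d (snd (prod_decode k)))))\<^sup>2" for k n
  have a0: "0 \<le> a k n" for k n
    by (simp add: a_def)
  have means: "(\<lambda>N. (\<Sum>n=1..N. a k n) / real N) \<longlonglongrightarrow> 0" for k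
    unfolding a_def by (rule small_means_tendsto_0) (rule T)
  obtain s :: "nat \<Rightarrow> nat" where s: "\<And>j. 1 \<le> s j" "strict_mono s" "has_density (range s) 1"
    and a: "\<And>k. (\<lambda>j. a k (s j)) \<longlonglongrightarrow> 0"
    by (rule joint_convergence_along_density_one[of a, OF a0 means]) (rule that)
  have "(\<lambda>j. cinner (blinfun_apply (power_op T (s j)) x) y) \<longlonglongrightarrow> 0"
    if "x \<in> range d" "y \<in> range d" for x y
  proof -
    obtain i i' where [simp]: "x = d i" "y = d i'"
      using \<open>x \<in> range d\<close> \<open>y \<in> range d\<close> by auto
    have "(\<lambda>j. (cmod (cinner (blinfun_apply (power_op T (s j)) x) y))\<^sup>2) \<longlonglongrightarrow> 0"
      using a[of "prod_encode (i, i')"] by (simp add: a_def)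
    from tendsto_real_sqrt[OF this] show ?thesis
      by (simp add: tendsto_norm_zero_iff)
  qed
  then have "limitin weak_operator_topology (\<lambda>j. power_op T (s j)) 0 sequentially"
    using assms(1) power_op_isometry[OF iso] isometries_subset_contractions
    by (intro limitin_weak_operator_topology_0I) auto
  then show ?thesis
    using s unfolding weakly_stable_along_density_one_def by blast
qed

lemma limitin_strong_operator_topologyI:
  fixes T :: "nat \<Rightarrow> 'a::complex_inner \<Rightarrow>\<^sub>L 'a"
  assumes T: "\<And>j. T j \<in> isometries" and R: "R \<in> isometries" and D: "closure D = UNIV"
    and lim: "\<And>x. x \<in> D \<Longrightarrow> (\<lambda>j. blinfun_apply (T j) x) \<longlonglongrightarrow> blinfun_apply R x"
  shows "limitin strong_operator_topology T R sequentially"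
  unfolding limitin_def
proof (intro conjI allI impI)
  have ev: "\<forall>\<^sub>F j in sequentially. norm (blinfun_apply (T j) x - blinfun_apply R x) < e" if "0 < e" for x e
  proof -
    have "0 < e / 3"
      using that by simp
    then obtain u where u: "u \<in> D" "norm (x - u) < e / 3"
      using D closure_approachable[of x D] by (metis UNIV_I dist_commute dist_norm)
    have "\<forall>\<^sub>F j in sequentially. norm (blinfun_apply (T j) u - blinfun_apply R u) < e / 3"
      using tendstoD[OF lim[OF u(1)], of "e / 3"] that by (simp add: dist_norm)
    then show ?thesis
    proof eventually_elim
      case (elim j)
      have "blinfun_apply (T j) x - blinfun_apply R x = blinfun_apply (T j) (x - u) +
          (blinfun_apply (T j) u - blinfun_apply R u) - blinfun_apply R (x - u)"
        by (simp add: blinfun.diff_right)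
      then have "norm (blinfun_apply (T j) x - blinfun_apply R x) \<le> norm (blinfun_apply (T j) (x - u)) +
          norm (blinfun_apply (T j) u - blinfun_apply R u) + norm (blinfun_apply R (x - u))"
        by (simp only:) (intro order_trans[OF norm_triangle_ineq4] add_right_mono norm_triangle_ineq)
      then show ?case
        using u(2) elim isometriesD(2)[OF T] isometriesD(2)[OF R] by simp
    qed
  qed
  fix U assume U: "openin strong_operator_topology U \<and> R \<in> U"
  obtain X e where X: "finite X" "0 < e"
    "\<forall>S. (\<forall>x\<in>X. norm (blinfun_apply S x - blinfun_apply R x) < e) \<longrightarrow> S \<in> U"
    by (rule strong_operator_topology_nbhd[OF U[THEN conjunct1] U[THEN conjunct2]]) (rule that)
  have "\<forall>\<^sub>F j in sequentially. \<forall>x\<in>X. norm (blinfun_apply (T j) x - blinfun_apply R x) < e"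
    using X ev by (intro eventually_ball_finite ballI) auto
  then show "\<forall>\<^sub>F j in sequentially. T j \<in> U"
    by (rule eventually_mono) (use X(3) in blast)
qed (simp add: strong_operator_topology_topspace)

lemma strong_limit_points_if_almost_scalar_powers:
  fixes T :: "'a::complex_hilbert_space \<Rightarrow>\<^sub>L 'a" and d :: "nat \<Rightarrow> 'a"
  assumes D: "closure (range d) = UNIV" and iso: "T \<in> isometries"
    and unit: "\<And>l. l \<in> \<Lambda> \<Longrightarrow> cmod l = 1"
    and T: "\<And>l j. l \<in> \<Lambda> \<Longrightarrow> T \<in> almost_scalar_power_isometries l (d ` {..j}) (inverse (real (Suc j))) (Suc j)"
  shows "strong_limit_points_of_powers \<Lambda> T"
  unfolding strong_limit_points_of_powers_def
proof
  fix l assume l: "l \<in> \<Lambda>"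
  have "\<exists>n\<ge>Suc j. \<forall>x\<in>d ` {..j}. norm (blinfun_apply (power_op T n) x - l *\<^sub>C x) < inverse (real (Suc j))" for j
    using T[OF l, of j] by (simp add: almost_scalar_power_isometries_def)
  then obtain n where n: "\<And>j. n j \<ge> Suc j"
    "\<And>j x. x \<in> d ` {..j} \<Longrightarrow> norm (blinfun_apply (power_op T (n j)) x - l *\<^sub>C x) < inverse (real (Suc j))"
    by metis
  have "filterlim n at_top sequentially"
    using n(1) by (intro filterlim_at_top_mono[OF filterlim_ident] always_eventually allI) (meson Suc_leD)
  moreover have "limitin strong_operator_topology (\<lambda>j. power_op T (n j)) (scalar_op l) sequentially"
  proof (rule limitin_strong_operator_topologyI[OF _ _ D])
    show "power_op T (n j) \<in> isometries" for j
      by (rule power_op_isometry[OF iso])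
    show "scalar_op l \<in> (isometries :: ('a \<Rightarrow>\<^sub>L 'a) set)"
      using unit[OF l]
      by (auto simp: isometries_def bounded_operators_def scalar_op.rep_eq norm_scaleC scaleC_scaleC mult.commute)
    show "(\<lambda>j. blinfun_apply (power_op T (n j)) x) \<longlonglongrightarrow> blinfun_apply (scalar_op l) x"
      if "x \<in> range d" for x
    proof -
      obtain i where i: "x = d i"
        using \<open>x \<in> range d\<close> by blast
      have "\<forall>\<^sub>F j in sequentially.
          norm (blinfun_apply (power_op T (n j)) x - l *\<^sub>C x) \<le> inverse (real (Suc j))"
        using eventually_ge_at_top[of i]
        by eventually_elim (use n(2) i in \<open>auto intro: less_imp_le\<close>)
      then have "(\<lambda>j. blinfun_apply (power_op T (n j)) x - l *\<^sub>C x) \<longlonglongrightarrow> 0"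
        using LIMSEQ_inverse_real_of_nat by (rule Lim_null_comparison)
      then show ?thesis
        by (simp add: scalar_op.rep_eq LIM_zero_iff)
    qed
  qed
  moreover have "1 \<le> n j" for j
    using n(1)[of j] by linarith
  ultimately show "\<exists>n. (\<forall>j. 1 \<le> n j) \<and> filterlim n at_top sequentially \<and>
      limitin strong_operator_topology (\<lambda>j. power_op T (n j)) (scalar_op l) sequentially"
    by blast
qed

theorem theorem3p3:
  fixes \<Lambda> :: "complex set"
  assumes "separable_space (euclidean :: 'a::complex_hilbert_space topology)"
    and "infinite_dimensional TYPE('a)"
    and "\<Lambda> \<subseteq> {z. cmod z = 1}"
    and "countable \<Lambda>"
  shows "residual_in (subtopology weak_operator_topology contractions)
           {T \<in> contractions :: ('a \<Rightarrow>\<^sub>L 'a) set.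
              weakly_stable_along_density_one T \<and> strong_limit_points_of_powers \<Lambda> T} \<and>
         residual_in (subtopology strong_operator_topology isometries)
           {T \<in> isometries :: ('a \<Rightarrow>\<^sub>L 'a) set.
              weakly_stable_along_density_one T \<and> strong_limit_points_of_powers \<Lambda> T} \<and>
         residual_in (subtopology strong_star_operator_topology unitaries)
           {T \<in> unitaries :: ('a \<Rightarrow>\<^sub>L 'a) set.
              weakly_stable_along_density_one T \<and> strong_limit_points_of_powers \<Lambda> T}"
proof -
  obtain D :: "'a set" where D: "countable D" "closure D = UNIV"
    using assms(1) by (auto simp: separable_space_def)
  then have "D \<noteq> {}"
    by auto
  define d where "d = from_nat_into D"
  have d: "range d = D"
    unfolding d_def using \<open>D \<noteq> {}\<close> D(1) by (rule range_from_nat_into)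
  define A where "A = (\<lambda>(i, k). small_mean_isometries (d i) (inverse (real (Suc k))))"
  define B where "B = (\<lambda>(l, j). almost_scalar_power_isometries l (d ` {..j}) (inverse (real (Suc j))) (Suc j))"
  define \<W> where "\<W> = range A \<union> B ` (\<Lambda> \<times> UNIV)"
  have W: "countable \<W>" "\<W> \<noteq> {}"
    using assms(4) by (auto simp: \<W>_def)
  have opn: "strongly_open_in_isometries W" if "W \<in> \<W>" for W
    using that by (auto simp: \<W>_def A_def B_def strongly_open_small_mean strongly_open_almost_scalar_power)
  have dense: "unitarily_dense_in_isometries W" if "W \<in> \<W>" for W
    using that assms(3)
    by (auto simp: \<W>_def A_def B_def subset_iff
        intro!: unitarily_dense_small_mean[OF assms(2)] unitarily_dense_almost_scalar_power[OF assms(2)])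
  have good: "weakly_stable_along_density_one T \<and> strong_limit_points_of_powers \<Lambda> T"
    if iso: "T \<in> isometries" and T: "\<And>W. W \<in> \<W> \<Longrightarrow> T \<in> W" for T
  proof
    have "A (i, k) \<in> \<W>" for i k
      by (simp add: \<W>_def)
    from T[OF this] have "T \<in> small_mean_isometries (d i) (inverse (real (Suc k)))" for i k
      by (simp add: A_def)
    then show "weakly_stable_along_density_one T"
      using D(2) d by (intro weakly_stable_if_small_means[of d]) auto
    have "B (l, j) \<in> \<W>" if "l \<in> \<Lambda>" for l j
      using that by (simp add: \<W>_def)
    from T[OF this] have "T \<in> almost_scalar_power_isometries l (d ` {..j}) (inverse (real (Suc j))) (Suc j)"
      if "l \<in> \<Lambda>" for l j
      using that by (simp add: B_def)
    then show "strong_limit_points_of_powers \<Lambda> T"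
      using D(2) d iso assms(3) by (intro strong_limit_points_if_almost_scalar_powers[of d]) auto
  qed
  note residual = residual_of_countably_many_strongly_open_dense[OF assms(2) D W,
      where P = "\<lambda>T. weakly_stable_along_density_one T \<and> strong_limit_points_of_powers \<Lambda> T"]
  show ?thesis
    by (rule conjI[OF residual(1) conjI[OF residual(2,3)]]) (fact opn | fact dense | fact good)+
qed

end
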